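(* Let $n \ge 1$ be an integer and let $\Lambda = (\lambda_1, \dots, \lambda_n) \in (\mathbb{C} \setminus \{0\})^n$ (the $\lambda_i$ are not necessarily distinct). Let $(\mathfrak{D}_{2n+2}(\Lambda), B)$ be the associated generalized complex diamond Lie algebra, and let $n_1, \dots, n_k$ be the multiplicities, up to sign, of the values occurring in $\Lambda$. Then the second Betti number of $\mathfrak{D}_{2n+2}(\Lambda)$ (with trivial complex coefficients) is $$b_2(\mathfrak{D}_{2n+2}(\Lambda)) = \sum_{i=1}^{k} n_i^2 - 1.$$
   Context: $\mathfrak{D}_{2n+2}(\Lambda)$ is the $(2n+2)$-dimensional complex Lie algebra with basis $\{X_0, \dots, X_n, Y_0, \dots, Y_n\}$ and non-trivial brackets $$[Y_0, X_i] = \lambda_i X_i, \quad [Y_0, Y_i] = -\lambda_i Y_i, \quad [X_i, Y_i] = \lambda_i X_0, \qquad 1 \le i \le n,$$ all other brackets of basis elements (apart from those implied by antisymmetry) being zero. It carries the non-degenerate invariant symmetric bilinear form $B$ with $B(X_i, Y_i) = 1$ for $0 \le i \le n$ and $B = 0$ on all other pairs of basis vectors; the quadratic Lie algebra $(\mathfrak{D}_{2n+2}(\Lambda), B)$ is called the generalized complex diamond Lie algebra. The numbers $n_1, \dots, n_k$ are defined as follows. Let $\{a_1, \dots, a_k\}$ be a subset (of $k$ distinct elements) of $\mathbb{C} \setminus \{0\}$ such that: (1) for every $i \in \{1, \dots, n\}$ there is a unique $j \in \{1, \dots, k\}$ with $a_j = \lambda_i$ or $a_j = -\lambda_i$; (2)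 for every $j \in \{1, \dots, k\}$ there is $i \in \{1, \dots, n\}$ with $a_j = \lambda_i$ or $a_j = -\lambda_i$. For each $j$, let $p_j$ (respectively $q_j$) be the number of indices $i$ with $\lambda_i = a_j$ (respectively $\lambda_i = -a_j$), and set $n_j := p_j + q_j$. Thus $\sum_{j=1}^k n_j = n$. For a finite-dimensional complex Lie algebra $\mathfrak{g}$, $b_2(\mathfrak{g}) = \dim_{\mathbb{C}} H^2(\mathfrak{g}, \mathbb{C})$, where $H^k(\mathfrak{g}, \mathbb{C})$ is the $k$-th Chevalley–Eilenberg cohomology with trivial coefficients, i.e. the cohomology of the complex $\Lambda^k(\mathfrak{g}^* )$ of skew-symmetric $k$-linear forms with differential $$\delta f(Z_0, \dots, Z_k) = \sum_{0 \le i < j \le k} (-1)^{i+j} f([Z_i, Z_j], Z_0, \dots, \widehat{Z_i}, \dots, \widehat{Z_j}, \dots, Z_k).$$ *)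

theory Defs
  imports "Jordan_Normal_Form.VS_Connect" "HOL-Algebra.AbelCoset" HOL.Complex
begin

section \<open>Quotient vector spaces\<close>

text \<open>The elements of the quotient are the cosets of W in V.  The ring multiplication and
  unit of the module record are irrelevant for vector spaces and left unspecified.  In the
  scalar multiple all members of the union coincide; the pointwise multiple of a coset would
  not be a coset for the scalar 0.\<close>

definition quotient_space :: "('a, 'v, 'm) module_scheme \<Rightarrow> 'v set \<Rightarrow> ('a, 'v set) module" where
  "quotient_space V W =
    \<lparr>carrier = a_rcosets\<^bsub>V\<^esub> W, mult = undefined, one = undefined,
     zero = W, add = (\<lambda>P Q. P <+>\<^bsub>V\<^esub> Q),
     smult = (\<lambda>c P. \<Union>p\<in>P. W +>\<^bsub>V\<^esub> (c \<odot>\<^bsub>V\<^esub> p))\<rparr>"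

context vectorspace
begin

lemma subspace_abelian_subgroup: assumes W: "VectorSpace.subspace K W V" shows "abelian_subgroup W V"
proof -
  have sm: "submodule K W V" using W by (simp add: VectorSpace.subspace_def)
  have neg: "\<ominus>\<^bsub>V\<^esub> w \<in> W" if "w \<in> W" for w
  proof -
    have "w \<in> carrier V" "(\<ominus>\<^bsub>K\<^esub> \<one>\<^bsub>K\<^esub>) \<odot>\<^bsub>V\<^esub> w \<in> W"
      using sm that R.a_inv_closed[OF R.one_closed] by (auto simp: submodule_def)
    then show ?thesis using smult_minus_1[of w] by simp
  qed
  have "additive_subgroup W V"
    using sm neg by (intro additive_subgroup.intro subgroup.intro)
      (auto simp: submodule_def a_inv_def[symmetric])
  then show ?thesis by (rule abelian_subgroupI3) (rule M.abelian_group_axioms)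
qed

lemma smult_coset:
  assumes W: "VectorSpace.subspace K W V" and c: "c \<in> carrier K" and v: "v \<in> carrier V"
  shows "(\<Union>p\<in>W +>\<^bsub>V\<^esub> v. W +>\<^bsub>V\<^esub> (c \<odot>\<^bsub>V\<^esub> p)) = W +>\<^bsub>V\<^esub> (c \<odot>\<^bsub>V\<^esub> v)"
proof -
  interpret W: abelian_subgroup W V by (rule subspace_abelian_subgroup[OF W])
  have sm: "submodule K W V" using W by (simp add: VectorSpace.subspace_def)
  have "W +>\<^bsub>V\<^esub> (c \<odot>\<^bsub>V\<^esub> p) = W +>\<^bsub>V\<^esub> (c \<odot>\<^bsub>V\<^esub> v)" if p: "p \<in> W +>\<^bsub>V\<^esub> v" for p
  proof -
    from p obtain w where w: "w \<in> W" "p = w \<oplus>\<^bsub>V\<^esub> v" by (auto simp: a_r_coset_def')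
    have wc: "w \<in> carrier V" "c \<odot>\<^bsub>V\<^esub> w \<in> W" using w sm c by (auto simp: submodule_def)
    then have "c \<odot>\<^bsub>V\<^esub> p \<in> W +>\<^bsub>V\<^esub> (c \<odot>\<^bsub>V\<^esub> v)"
      using w c v by (auto simp: a_r_coset_def' smult_r_distr)
    then show ?thesis
      using c v by (intro M.add.repr_independence[OF _ _ W.a_subgroup, folded a_r_coset_def, symmetric]) auto
  qed
  moreover have "v \<in> W +>\<^bsub>V\<^esub> v" by (rule W.a_rcos_self[OF v])
  ultimately show ?thesis by blast
qed

lemma quotient_space_vectorspace:
  assumes W: "VectorSpace.subspace K W V"
  shows "vectorspace K (quotient_space V W)"
proof -
  interpret W: abelian_subgroup W V by (rule subspace_abelian_subgroup[OF W])
  let ?Q = "quotient_space V W"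
  have C: "P \<in> carrier ?Q \<longleftrightarrow> (\<exists>v\<in>carrier V. P = W +>\<^bsub>V\<^esub> v)" for P
    by (auto simp: quotient_space_def A_RCOSETS_def')
  have A: "(W +>\<^bsub>V\<^esub> u) \<oplus>\<^bsub>?Q\<^esub> (W +>\<^bsub>V\<^esub> v) = W +>\<^bsub>V\<^esub> (u \<oplus>\<^bsub>V\<^esub> v)" if "u \<in> carrier V" "v \<in> carrier V" for u v
    using that by (simp add: quotient_space_def W.a_rcos_sum)
  have S: "c \<odot>\<^bsub>?Q\<^esub> (W +>\<^bsub>V\<^esub> v) = W +>\<^bsub>V\<^esub> (c \<odot>\<^bsub>V\<^esub> v)" if "c \<in> carrier K" "v \<in> carrier V" for c v
    using smult_coset[OF W that] by (simp add: quotient_space_def)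
  have Z: "\<zero>\<^bsub>?Q\<^esub> = W +>\<^bsub>V\<^esub> \<zero>\<^bsub>V\<^esub>"
    by (simp add: quotient_space_def M.a_coset_add_zero W.a_subset)
  have "abelian_group ?Q"
  proof (rule abelian_groupI, goal_cases)
    case (3 P Q R)
    then show ?case by (auto simp: C A M.a_assoc)
  next
    case (4 P Q)
    then obtain u v where "u \<in> carrier V" "v \<in> carrier V"
      "P = W +>\<^bsub>V\<^esub> u" "Q = W +>\<^bsub>V\<^esub> v" by (auto simp: C)
    then show ?case using M.a_comm[of u v] by (simp add: A)
  next
    case (6 P)
    then obtain v where v: "v \<in> carrier V" "P = W +>\<^bsub>V\<^esub> v" by (auto simp: C)
    then have "(W +>\<^bsub>V\<^esub> (\<ominus>\<^bsub>V\<^esub> v)) \<oplus>\<^bsub>?Q\<^esub> P = \<zero>\<^bsub>?Q\<^esub>" by (simp add: A Z M.l_neg)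
    moreover have "W +>\<^bsub>V\<^esub> (\<ominus>\<^bsub>V\<^esub> v) \<in> carrier ?Q" using v C by blast
    ultimately show ?case by blast
  qed (auto simp: C A Z)
  then have "Module.module K ?Q"
    by (intro moduleI) (auto simp: C A S Z R.cring_axioms R.is_cring smult_l_distr smult_r_distr smult_assoc1)
  then show ?thesis by (simp add: vectorspace_def field_axioms)
qed

end


section \<open>Complex Lie algebras\<close>

record ('a, 'v) lie_struct = "('a, 'v) module" +
  lbracket :: "'v \<Rightarrow> 'v \<Rightarrow> 'v"

locale complex_lie_algebra =
  fixes L :: "(complex, 'v, 'm) lie_struct_scheme" (structure)
  assumes vs: "vectorspace class_ring L"
    and bracket_closed:
      "\<lbrakk>x \<in> carrier L; y \<in> carrier L\<rbrakk> \<Longrightarrow> lbracket L x y \<in> carrier L"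
    and bracket_add:
      "\<lbrakk>x \<in> carrier L; y \<in> carrier L; z \<in> carrier L\<rbrakk>
        \<Longrightarrow> lbracket L (x \<oplus> y) z = lbracket L x z \<oplus> lbracket L y z"
      "\<lbrakk>x \<in> carrier L; y \<in> carrier L; z \<in> carrier L\<rbrakk>
        \<Longrightarrow> lbracket L z (x \<oplus> y) = lbracket L z x \<oplus> lbracket L z y"
    and bracket_smult:
      "\<lbrakk>x \<in> carrier L; y \<in> carrier L\<rbrakk> \<Longrightarrow> lbracket L (c \<odot> x) y = c \<odot> lbracket L x y"
      "\<lbrakk>x \<in> carrier L; y \<in> carrier L\<rbrakk> \<Longrightarrow> lbracket L x (c \<odot> y) = c \<odot> lbracket L x y"
    and bracket_self: "x \<in> carrier L \<Longrightarrow> lbracket L x x = \<zero>"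
    and jacobi:
      "\<lbrakk>x \<in> carrier L; y \<in> carrier L; z \<in> carrier L\<rbrakk>
        \<Longrightarrow> lbracket L x (lbracket L y z) \<oplus> lbracket L y (lbracket L z x)
              \<oplus> lbracket L z (lbracket L x y) = \<zero>"

locale complex_quadratic_lie_algebra = complex_lie_algebra L
  for L :: "(complex, 'v, 'm) lie_struct_scheme" (structure) +
  fixes B :: "'v \<Rightarrow> 'v \<Rightarrow> complex"
  assumes form_add:
      "\<lbrakk>x \<in> carrier L; y \<in> carrier L; z \<in> carrier L\<rbrakk> \<Longrightarrow> B (x \<oplus> y) z = B x z + B y z"
    and form_smult: "\<lbrakk>x \<in> carrier L; y \<in> carrier L\<rbrakk> \<Longrightarrow> B (c \<odot> x) y = c * B x y"
    and form_sym: "\<lbrakk>x \<in> carrier L; y \<in> carrier L\<rbrakk> \<Longrightarrow> B x y = B y x"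
    and form_nondegenerate:
      "\<lbrakk>x \<in> carrier L; \<And>y. y \<in> carrier L \<Longrightarrow> B x y = 0\<rbrakk> \<Longrightarrow> x = \<zero>"
    and form_invariant:
      "\<lbrakk>x \<in> carrier L; y \<in> carrier L; z \<in> carrier L\<rbrakk>
        \<Longrightarrow> B (lbracket L x y) z = B x (lbracket L y z)"


section \<open>Chevalley--Eilenberg cohomology with trivial coefficients\<close>

text \<open>A \<open>k\<close>-linear form takes its arguments as a list of length \<open>k\<close>.  Off the lists of length
  \<open>k\<close> over the carrier it is required to vanish, so that a form is determined by its values
  on the Lie algebra and equality of forms is equality of functions.\<close>

definition multilinear_form ::
    "(complex, 'v, 'm) lie_struct_scheme \<Rightarrow> nat \<Rightarrow> ('v list \<Rightarrow> complex) \<Rightarrow> bool" where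
  "multilinear_form L k f \<longleftrightarrow>
    (\<forall>zs i u v. length zs = k \<and> set zs \<subseteq> carrier L \<and> i < k \<and> u \<in> carrier L \<and> v \<in> carrier L
        \<longrightarrow> f (zs[i := u \<oplus>\<^bsub>L\<^esub> v]) = f (zs[i := u]) + f (zs[i := v])) \<and>
    (\<forall>zs i u c. length zs = k \<and> set zs \<subseteq> carrier L \<and> i < k \<and> u \<in> carrier L
        \<longrightarrow> f (zs[i := c \<odot>\<^bsub>L\<^esub> u]) = c * f (zs[i := u]))"

definition skew_symmetric_form ::
    "(complex, 'v, 'm) lie_struct_scheme \<Rightarrow> nat \<Rightarrow> ('v list \<Rightarrow> complex) \<Rightarrow> bool" where
  "skew_symmetric_form L k f \<longleftrightarrow>
    (\<forall>zs i j. length zs = k \<and> set zs \<subseteq> carrier L \<and> i < j \<and> j < k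
        \<longrightarrow> f (zs[i := zs ! j, j := zs ! i]) = - f zs)"

definition cochains ::
    "(complex, 'v, 'm) lie_struct_scheme \<Rightarrow> nat \<Rightarrow> ('v list \<Rightarrow> complex) set" where
  "cochains L k =
    {f. multilinear_form L k f \<and> skew_symmetric_form L k f \<and>
        (\<forall>zs. \<not> (length zs = k \<and> set zs \<subseteq> carrier L) \<longrightarrow> f zs = 0)}"

definition ce_differential ::
    "(complex, 'v, 'm) lie_struct_scheme \<Rightarrow> nat \<Rightarrow> ('v list \<Rightarrow> complex) \<Rightarrow> 'v list \<Rightarrow> complex" where
  "ce_differential L k f zs =
    (if length zs = Suc k \<and> set zs \<subseteq> carrier L
     then \<Sum>j\<le>k. \<Sum>i<j. (-1) ^ (i + j) *
            f (lbracket L (zs ! i) (zs ! j) # nths zs (- {i, j}))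
     else 0)"

definition cocycles ::
    "(complex, 'v, 'm) lie_struct_scheme \<Rightarrow> nat \<Rightarrow> ('v list \<Rightarrow> complex) set" where
  "cocycles L k = {f \<in> cochains L k. ce_differential L k f = (\<lambda>_. 0)}"

definition coboundaries ::
    "(complex, 'v, 'm) lie_struct_scheme \<Rightarrow> nat \<Rightarrow> ('v list \<Rightarrow> complex) set" where
  "coboundaries L k =
    (case k of 0 \<Rightarrow> {\<lambda>_. 0} | Suc m \<Rightarrow> ce_differential L m ` cochains L m)"

definition cocycle_space ::
    "(complex, 'v, 'm) lie_struct_scheme \<Rightarrow> nat \<Rightarrow> (complex, 'v list \<Rightarrow> complex) module" where
  "cocycle_space L k =
    \<lparr>carrier = cocycles L k, mult = undefined, one = undefined,
     zero = (\<lambda>_. 0), add = (\<lambda>f g zs. f zs + g zs), smult = (\<lambda>c f zs. c * f zs)\<rparr>"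

definition ce_cohomology ::
    "(complex, 'v, 'm) lie_struct_scheme \<Rightarrow> nat \<Rightarrow> (complex, ('v list \<Rightarrow> complex) set) module" where
  "ce_cohomology L k = quotient_space (cocycle_space L k) (coboundaries L k)"

definition betti :: "(complex, 'v, 'm) lie_struct_scheme \<Rightarrow> nat \<Rightarrow> nat" where
  "betti L k = vectorspace.dim class_ring (ce_cohomology L k)"


section \<open>Generalized complex diamond Lie algebras\<close>

datatype diamond_basis = BX nat | BY nat

type_synonym diamond_vec = "diamond_basis \<Rightarrow> complex"

definition diamond_indices :: "nat \<Rightarrow> diamond_basis set" where
  "diamond_indices n = BX ` {0..n} \<union> BY ` {0..n}"

definition basis_vec :: "diamond_basis \<Rightarrow> diamond_vec" where
  "basis_vec b = (\<lambda>c. if c = b then 1 else 0)"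

fun basis_bracket :: "(nat \<Rightarrow> complex) \<Rightarrow> diamond_basis \<Rightarrow> diamond_basis \<Rightarrow> diamond_vec" where
  "basis_bracket \<Lambda> (BX i) (BX j) = (\<lambda>_. 0)"
| "basis_bracket \<Lambda> (BY i) (BX j) =
    (if i = 0 \<and> j \<noteq> 0 then (\<lambda>c. \<Lambda> j * basis_vec (BX j) c)
     else if i \<noteq> 0 \<and> i = j then (\<lambda>c. - \<Lambda> i * basis_vec (BX 0) c)
     else (\<lambda>_. 0))"
| "basis_bracket \<Lambda> (BX i) (BY j) =
    (if j = 0 \<and> i \<noteq> 0 then (\<lambda>c. - \<Lambda> i * basis_vec (BX i) c)
     else if i \<noteq> 0 \<and> i = j then (\<lambda>c. \<Lambda> i * basis_vec (BX 0) c)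
     else (\<lambda>_. 0))"
| "basis_bracket \<Lambda> (BY i) (BY j) =
    (if i = 0 \<and> j \<noteq> 0 then (\<lambda>c. - \<Lambda> j * basis_vec (BY j) c)
     else if j = 0 \<and> i \<noteq> 0 then (\<lambda>c. \<Lambda> i * basis_vec (BY i) c)
     else (\<lambda>_. 0))"

text \<open>Only the values \<open>\<Lambda> 1, \<dots>, \<Lambda> n\<close> matter.\<close>

definition diamond :: "nat \<Rightarrow> (nat \<Rightarrow> complex) \<Rightarrow> (complex, diamond_vec) lie_struct" where
  "diamond n \<Lambda> =
    \<lparr>carrier = {v. \<forall>b. b \<notin> diamond_indices n \<longrightarrow> v b = 0},
     mult = undefined, one = undefined,
     zero = (\<lambda>_. 0), add = (\<lambda>u v b. u b + v b), smult = (\<lambda>c v b. c * v b),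
     lbracket = (\<lambda>u v c. \<Sum>a\<in>diamond_indices n. \<Sum>b\<in>diamond_indices n.
                            u a * v b * basis_bracket \<Lambda> a b c)\<rparr>"

definition diamond_form :: "nat \<Rightarrow> diamond_vec \<Rightarrow> diamond_vec \<Rightarrow> complex" where
  "diamond_form n u v = (\<Sum>i\<in>{0..n}. u (BX i) * v (BY i) + u (BY i) * v (BX i))"

lemma sum_diamond_indices:
  "(\<Sum>b\<in>diamond_indices n. g b) = (\<Sum>i\<in>{0..n}. g (BX i)) + (\<Sum>i\<in>{0..n}. g (BY i))"
  for g :: "diamond_basis \<Rightarrow> complex"
  unfolding diamond_indices_def
  by (subst sum.union_disjoint) (auto simp: sum.reindex inj_on_def)

lemma diamond_bracket_basis:
  assumes "a \<in> diamond_indices n" "b \<in> diamond_indices n"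
  shows "lbracket (diamond n \<Lambda>) (basis_vec a) (basis_vec b) = basis_bracket \<Lambda> a b"
proof
  fix c
  have fin: "finite (diamond_indices n)" by (simp add: diamond_indices_def)
  have "lbracket (diamond n \<Lambda>) (basis_vec a) (basis_vec b) c =
      (\<Sum>a'\<in>diamond_indices n. if a' = a then
         (\<Sum>b'\<in>diamond_indices n. if b' = b then basis_bracket \<Lambda> a b c else 0) else 0)"
    unfolding diamond_def basis_vec_def
    by (auto intro!: sum.cong)
  then show "lbracket (diamond n \<Lambda>) (basis_vec a) (basis_vec b) c = basis_bracket \<Lambda> a b c"
    using assms fin by simp
qed

lemma diamond_bracket_expand:
  "lbracket (diamond n \<Lambda>) u v c =
    (\<Sum>i\<in>{1..n}. \<Lambda> i *
      ((u (BX i) * v (BY i) - u (BY i) * v (BX i)) * basis_vec (BX 0) c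
       + (u (BY 0) * v (BX i) - u (BX i) * v (BY 0)) * basis_vec (BX i) c
       - (u (BY 0) * v (BY i) - u (BY i) * v (BY 0)) * basis_vec (BY i) c))"
proof -
  let ?S = "{0..n}" and ?T = "{1..n}"
  have S0: "(\<Sum>i\<in>?S. g i) = g 0 + (\<Sum>i\<in>?T. g i)" for g :: "nat \<Rightarrow> complex"
    by (simp add: sum.atLeast_Suc_atMost)
  have XY: "(\<Sum>j\<in>?S. u (BX i) * v (BY j) * basis_bracket \<Lambda> (BX i) (BY j) c) =
      \<Lambda> i * (u (BX i) * v (BY i) * basis_vec (BX 0) c - u (BX i) * v (BY 0) * basis_vec (BX i) c)"
    if "i \<in> ?T" for i
  proof -
    have "(\<Sum>j\<in>?T. u (BX i) * v (BY j) * basis_bracket \<Lambda> (BX i) (BY j) c) =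
        (\<Sum>j\<in>?T. if j = i then u (BX i) * v (BY i) * (\<Lambda> i * basis_vec (BX 0) c) else 0)"
      using that by (intro sum.cong) auto
    with that show ?thesis by (simp add: S0 algebra_simps)
  qed
  have YX: "(\<Sum>j\<in>?S. u (BY i) * v (BX j) * basis_bracket \<Lambda> (BY i) (BX j) c) =
      - \<Lambda> i * u (BY i) * v (BX i) * basis_vec (BX 0) c"
    if "i \<in> ?T" for i
  proof -
    have "(\<Sum>j\<in>?T. u (BY i) * v (BX j) * basis_bracket \<Lambda> (BY i) (BX j) c) =
        (\<Sum>j\<in>?T. if j = i then u (BY i) * v (BX i) * (- \<Lambda> i * basis_vec (BX 0) c) else 0)"
      using that by (intro sum.cong) auto
    with that show ?thesis by (simp add: S0 algebra_simps)
  qed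
  have YY: "(\<Sum>j\<in>?S. u (BY i) * v (BY j) * basis_bracket \<Lambda> (BY i) (BY j) c) =
      \<Lambda> i * u (BY i) * v (BY 0) * basis_vec (BY i) c"
    if "i \<in> ?T" for i
  proof -
    have "(\<Sum>j\<in>?T. u (BY i) * v (BY j) * basis_bracket \<Lambda> (BY i) (BY j) c) = 0"
      using that by (intro sum.neutral) auto
    with that show ?thesis by (simp add: S0 algebra_simps)
  qed
  have X0: "(\<Sum>j\<in>?S. u (BX 0) * v (BY j) * basis_bracket \<Lambda> (BX 0) (BY j) c) = 0"
    by (intro sum.neutral) auto
  have Y0X: "(\<Sum>j\<in>?S. u (BY 0) * v (BX j) * basis_bracket \<Lambda> (BY 0) (BX j) c) =
      (\<Sum>j\<in>?T. \<Lambda> j * u (BY 0) * v (BX j) * basis_vec (BX j) c)"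
    by (subst S0) (auto intro!: sum.cong)
  have Y0Y: "(\<Sum>j\<in>?S. u (BY 0) * v (BY j) * basis_bracket \<Lambda> (BY 0) (BY j) c) =
      (\<Sum>j\<in>?T. - \<Lambda> j * u (BY 0) * v (BY j) * basis_vec (BY j) c)"
    by (subst S0) (auto intro!: sum.cong)
  have "lbracket (diamond n \<Lambda>) u v c =
      (\<Sum>i\<in>?S. \<Sum>j\<in>?S. u (BX i) * v (BY j) * basis_bracket \<Lambda> (BX i) (BY j) c) +
      ((\<Sum>i\<in>?S. \<Sum>j\<in>?S. u (BY i) * v (BX j) * basis_bracket \<Lambda> (BY i) (BX j) c) +
       (\<Sum>i\<in>?S. \<Sum>j\<in>?S. u (BY i) * v (BY j) * basis_bracket \<Lambda> (BY i) (BY j) c))"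
    by (simp add: diamond_def sum_diamond_indices sum.distrib)
  also have "\<dots> =
      (\<Sum>i\<in>?T. \<Lambda> i * (u (BX i) * v (BY i) * basis_vec (BX 0) c
                    - u (BX i) * v (BY 0) * basis_vec (BX i) c)) +
      (((\<Sum>j\<in>?T. \<Lambda> j * u (BY 0) * v (BX j) * basis_vec (BX j) c) +
        (\<Sum>i\<in>?T. - \<Lambda> i * u (BY i) * v (BX i) * basis_vec (BX 0) c)) +
       ((\<Sum>j\<in>?T. - \<Lambda> j * u (BY 0) * v (BY j) * basis_vec (BY j) c) +
        (\<Sum>i\<in>?T. \<Lambda> i * u (BY i) * v (BY 0) * basis_vec (BY i) c)))"
    unfolding S0[of "\<lambda>i. \<Sum>j\<in>?S. u (BX i) * v (BY j) * basis_bracket \<Lambda> (BX i) (BY j) c"]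
      S0[of "\<lambda>i. \<Sum>j\<in>?S. u (BY i) * v (BX j) * basis_bracket \<Lambda> (BY i) (BX j) c"]
      S0[of "\<lambda>i. \<Sum>j\<in>?S. u (BY i) * v (BY j) * basis_bracket \<Lambda> (BY i) (BY j) c"]
      X0 Y0X Y0Y
    by (simp only: sum.cong[OF refl XY] sum.cong[OF refl YX] sum.cong[OF refl YY] add_0)
  also have "\<dots> = (\<Sum>i\<in>?T. \<Lambda> i *
      ((u (BX i) * v (BY i) - u (BY i) * v (BX i)) * basis_vec (BX 0) c
       + (u (BY 0) * v (BX i) - u (BX i) * v (BY 0)) * basis_vec (BX i) c
       - (u (BY 0) * v (BY i) - u (BY i) * v (BY 0)) * basis_vec (BY i) c))"
    unfolding sum.distrib[symmetric] by (intro sum.cong) (auto simp: algebra_simps)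
  finally show ?thesis .
qed

lemma diamond_bracket_coords:
  "lbracket (diamond n \<Lambda>) u v (BY 0) = 0"
  "lbracket (diamond n \<Lambda>) u v (BX 0) =
    (\<Sum>i\<in>{1..n}. \<Lambda> i * (u (BX i) * v (BY i) - u (BY i) * v (BX i)))"
  "lbracket (diamond n \<Lambda>) u v (BX (Suc i)) =
    (if Suc i \<le> n then \<Lambda> (Suc i) * (u (BY 0) * v (BX (Suc i)) - u (BX (Suc i)) * v (BY 0)) else 0)"
  "lbracket (diamond n \<Lambda>) u v (BY (Suc i)) =
    (if Suc i \<le> n then - \<Lambda> (Suc i) * (u (BY 0) * v (BY (Suc i)) - u (BY (Suc i)) * v (BY 0)) else 0)"
proof -
  have pick: "(\<Sum>j\<in>{1..n}. g j * (if Suc i = j then 1 else 0)) = (if Suc i \<le> n then g (Suc i) else 0)"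
    for g :: "nat \<Rightarrow> complex"
    by (simp add: if_distrib[of "\<lambda>x. _ * x"] cong: if_cong)
  show "lbracket (diamond n \<Lambda>) u v (BY 0) = 0"
    unfolding diamond_bracket_expand by (intro sum.neutral) (auto simp: basis_vec_def)
  show "lbracket (diamond n \<Lambda>) u v (BX 0) =
    (\<Sum>i\<in>{1..n}. \<Lambda> i * (u (BX i) * v (BY i) - u (BY i) * v (BX i)))"
    unfolding diamond_bracket_expand by (intro sum.cong) (auto simp: basis_vec_def)
  show "lbracket (diamond n \<Lambda>) u v (BX (Suc i)) =
    (if Suc i \<le> n then \<Lambda> (Suc i) * (u (BY 0) * v (BX (Suc i)) - u (BX (Suc i)) * v (BY 0)) else 0)"
    unfolding diamond_bracket_expand
    by (subst pick[symmetric]) (intro sum.cong, auto simp: basis_vec_def)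
  show "lbracket (diamond n \<Lambda>) u v (BY (Suc i)) =
    (if Suc i \<le> n then - \<Lambda> (Suc i) * (u (BY 0) * v (BY (Suc i)) - u (BY (Suc i)) * v (BY 0)) else 0)"
    unfolding diamond_bracket_expand
    by (subst pick[symmetric]) (intro sum.cong, auto simp: basis_vec_def)
qed

lemma not_in_diamond_indices: "b \<notin> diamond_indices n \<longleftrightarrow> (\<exists>i>n. b = BX i \<or> b = BY i)"
  by (cases b) (auto simp: diamond_indices_def image_iff not_le)

lemma diamond_vectorspace: "vectorspace class_ring (diamond n \<Lambda>)"
proof -
  have "\<exists>y\<in>carrier (diamond n \<Lambda>). y \<oplus>\<^bsub>diamond n \<Lambda>\<^esub> x = \<zero>\<^bsub>diamond n \<Lambda>\<^esub>"
    if "x \<in> carrier (diamond n \<Lambda>)" for x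
    using that by (intro bexI[of _ "\<lambda>b. - x b"]) (auto simp: diamond_def)
  then have "Module.module class_ring (diamond n \<Lambda>)"
    by (intro Module.moduleI abelian_groupI class_cring.cring_axioms)
       (auto simp: diamond_def algebra_simps)
  then show ?thesis
    by (simp add: vectorspace_def class_field.field_axioms)
qed

theorem diamond_quadratic_lie_algebra:
  "complex_quadratic_lie_algebra (diamond n \<Lambda>) (diamond_form n)"
proof -
  let ?L = "diamond n \<Lambda>"
  have carr: "x \<in> carrier ?L \<longleftrightarrow> (\<forall>i>n. x (BX i) = 0 \<and> x (BY i) = 0)" for x
    by (auto simp: diamond_def not_in_diamond_indices)
  have simps: "x \<oplus>\<^bsub>?L\<^esub> y = (\<lambda>b. x b + y b)" "c \<odot>\<^bsub>?L\<^esub> x = (\<lambda>b. c * x b)" "\<zero>\<^bsub>?L\<^esub> = (\<lambda>_. 0)" for x y c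
    by (simp_all add: diamond_def)
  have eqI: "x = y" if "x (BY 0) = y (BY 0)" "x (BX 0) = y (BX 0)"
    "\<And>i. x (BX (Suc i)) = y (BX (Suc i))" "\<And>i. x (BY (Suc i)) = y (BY (Suc i))" for x y :: diamond_vec
  proof
    fix b show "x b = y b" by (cases b; metis that not0_implies_Suc)
  qed
  have br: "lbracket ?L x y (BX i) = (if i \<le> n then \<Lambda> i * (x (BY 0) * y (BX i) - x (BX i) * y (BY 0)) else 0)"
    "lbracket ?L x y (BY i) = (if i \<le> n then - \<Lambda> i * (x (BY 0) * y (BY i) - x (BY i) * y (BY 0)) else 0)"
    if "i \<ge> 1" for x y i
    using that by (cases i; simp add: diamond_bracket_coords)+
  show ?thesis
  proof (intro complex_quadratic_lie_algebra.intro complex_lie_algebra.intro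
      complex_quadratic_lie_algebra_axioms.intro)
    show "vectorspace class_ring ?L" by (rule diamond_vectorspace)
  next
    fix x y z c
    show "lbracket ?L x y \<in> carrier ?L"
      unfolding carr by (auto simp: br)
    show "lbracket ?L (x \<oplus>\<^bsub>?L\<^esub> y) z = lbracket ?L x z \<oplus>\<^bsub>?L\<^esub> lbracket ?L y z"
      "lbracket ?L z (x \<oplus>\<^bsub>?L\<^esub> y) = lbracket ?L z x \<oplus>\<^bsub>?L\<^esub> lbracket ?L z y"
      "lbracket ?L (c \<odot>\<^bsub>?L\<^esub> x) y = c \<odot>\<^bsub>?L\<^esub> lbracket ?L x y"
      "lbracket ?L x (c \<odot>\<^bsub>?L\<^esub> y) = c \<odot>\<^bsub>?L\<^esub> lbracket ?L x y"
      "lbracket ?L x x = \<zero>\<^bsub>?L\<^esub>"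
      unfolding simps
      by (rule eqI; auto simp: diamond_bracket_coords algebra_simps sum_distrib_left
          sum.distrib sum_subtractf)+
    show "lbracket ?L x (lbracket ?L y z) \<oplus>\<^bsub>?L\<^esub> lbracket ?L y (lbracket ?L z x)
        \<oplus>\<^bsub>?L\<^esub> lbracket ?L z (lbracket ?L x y) = \<zero>\<^bsub>?L\<^esub>"
    proof (unfold simps, rule eqI)
      show "lbracket ?L x (lbracket ?L y z) (BX 0) + lbracket ?L y (lbracket ?L z x) (BX 0)
        + lbracket ?L z (lbracket ?L x y) (BX 0) = 0"
        unfolding diamond_bracket_coords(2) sum.distrib[symmetric]
        by (intro sum.neutral) (auto simp: br algebra_simps)
    qed (auto simp: diamond_bracket_coords algebra_simps)
    show "diamond_form n (x \<oplus>\<^bsub>?L\<^esub> y) z = diamond_form n x z + diamond_form n y z"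
      "diamond_form n (c \<odot>\<^bsub>?L\<^esub> x) y = c * diamond_form n x y"
      "diamond_form n x y = diamond_form n y x"
      unfolding simps diamond_form_def
      by (auto simp: algebra_simps sum_distrib_left sum.distrib)
    show "diamond_form n (lbracket ?L x y) z = diamond_form n x (lbracket ?L y z)"
    proof -
      have S0: "(\<Sum>i\<in>{0..n}. g i) = g 0 + (\<Sum>i\<in>{1..n}. g i)" for g :: "nat \<Rightarrow> complex"
        by (simp add: sum.atLeast_Suc_atMost)
      show ?thesis
        unfolding diamond_form_def S0 diamond_bracket_coords(1,2) sum_distrib_left sum_distrib_right
        by (simp only: mult_zero_left mult_zero_right add_0 add_0_right sum.distrib[symmetric])
           (intro sum.cong, auto simp: br algebra_simps)
    qed
  next
    fix x assume x: "x \<in> carrier ?L" and nd: "\<And>y. y \<in> carrier ?L \<Longrightarrow> diamond_form n x y = 0"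
    have "x (BX i) = 0 \<and> x (BY i) = 0" if "i \<le> n" for i
    proof -
      have "diamond_form n x (basis_vec (BY i)) = (\<Sum>j\<in>{0..n}. if j = i then x (BX j) else 0)"
        "diamond_form n x (basis_vec (BX i)) = (\<Sum>j\<in>{0..n}. if j = i then x (BY j) else 0)"
        unfolding diamond_form_def basis_vec_def by ((intro sum.cong; auto)+)
      moreover have "basis_vec (BX i) \<in> carrier ?L" "basis_vec (BY i) \<in> carrier ?L"
        unfolding carr using that by (auto simp: basis_vec_def)
      ultimately show ?thesis using nd that by fastforce
    qed
    then have "x b = 0" for b
      using x unfolding carr by (cases b) (metis not_le)+
    then show "x = \<zero>\<^bsub>?L\<^esub>" by (auto simp: simps)
  qed
qed

end

theory Submission
  imports Defs
begin

text \<open>For each \<open>i\<close> choose the sign for which \<open>\<mu> i = \<plusminus>\<lambda>\<^sub>i\<close> is one of the \<open>a\<^sub>j\<close>; then \<open>ad Y\<^sub>0\<close> is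
  diagonal with weight \<open>\<mu> i\<close> on one of \<open>X\<^sub>i, Y\<^sub>i\<close> (called \<open>pos i\<close>), weight \<open>- \<mu> i\<close> on the other
  (called \<open>neg i\<close>), and weight \<open>0\<close> on \<open>X\<^sub>0, Y\<^sub>0\<close>.  Evaluating the cocycle identity on triples
  containing \<open>Y\<^sub>0\<close> shows that a 2-cocycle is free exactly on the pairs \<open>(Y\<^sub>0, pos i)\<close>,
  \<open>(Y\<^sub>0, neg i)\<close> and on the pairs \<open>(pos i, neg j)\<close> with \<open>\<mu> i = \<mu> j\<close>, and vanishes on all other pairs
  of basis vectors.  Coboundaries take arbitrary values on the pairs with \<open>Y\<^sub>0\<close>, and on the others
  they form the line spanned by \<open>(pos i, neg j) \<mapsto> \<delta>\<^sub>i\<^sub>j \<mu> i\<close>.  Hence \<open>b\<^sub>2\<close> is the number of pairs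
  \<open>(i, j)\<close> with \<open>\<mu> i = \<mu> j\<close>, minus one.\<close>

section \<open>Dimension of a quotient by a common kernel\<close>

text \<open>The family \<open>\<phi>\<close> induces an isomorphism from \<open>V\<close> modulo its
  common kernel onto the functions on \<open>I\<close>. After numbering \<open>I\<close>, the proof
  builds the inverse map, from coordinate vectors of length \<open>card I\<close> to cosets, and
  compares dimensions.\<close>

lemma dim_quotient_space_kernel:
  fixes V :: "('a :: field, 'v, 'm) module_scheme" and \<phi> :: "'v \<Rightarrow> 'i \<Rightarrow> 'a"
  assumes V: "vectorspace class_ring V" and I: "finite I"
    and add: "\<And>u v i. \<lbrakk>u \<in> carrier V; v \<in> carrier V; i \<in> I\<rbrakk> \<Longrightarrow> \<phi> (u \<oplus>\<^bsub>V\<^esub> v) i = \<phi> u i + \<phi> v i"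
    and smult: "\<And>c v i. \<lbrakk>v \<in> carrier V; i \<in> I\<rbrakk> \<Longrightarrow> \<phi> (c \<odot>\<^bsub>V\<^esub> v) i = c * \<phi> v i"
    and surj: "\<And>c. \<exists>v\<in>carrier V. \<forall>i\<in>I. \<phi> v i = c i"
  shows "vectorspace.dim class_ring (quotient_space V {v \<in> carrier V. \<forall>i\<in>I. \<phi> v i = 0}) = card I"
proof -
  interpret V: vectorspace class_ring V by (rule V)
  let ?W = "{v \<in> carrier V. \<forall>i\<in>I. \<phi> v i = 0}"
  let ?Q = "quotient_space V ?W"
  have \<phi>0: "\<phi> \<zero>\<^bsub>V\<^esub> i = 0" if "i \<in> I" for i
    using smult[of "\<zero>\<^bsub>V\<^esub>" i 0] that V.lmult_0[of "\<zero>\<^bsub>V\<^esub>"] by simp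
  have "submodule class_ring ?W V"
    using V.module_axioms by (intro submodule.intro) (auto simp: \<phi>0 add smult intro: V.smult_closed)
  then have W: "VectorSpace.subspace class_ring ?W V"
    using V by (simp add: VectorSpace.subspace_def)
  have abW: "abelian_subgroup ?W V" by (rule V.subspace_abelian_subgroup[OF W])
  have Q: "vectorspace class_ring ?Q" by (rule V.quotient_space_vectorspace[OF W])
  \<comment> \<open>Cosets are the fibres of \<open>\<phi>\<close>, so from here on an equation
    between cosets is an equation between coordinates.\<close>
  have coset: "?W +>\<^bsub>V\<^esub> u = {v \<in> carrier V. \<forall>i\<in>I. \<phi> v i = \<phi> u i}" if u: "u \<in> carrier V" for u
  proof (intro equalityI subsetI)
    fix v assume "v \<in> {v \<in> carrier V. \<forall>i\<in>I. \<phi> v i = \<phi> u i}"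
    then have v: "v \<in> carrier V" "\<And>i. i \<in> I \<Longrightarrow> \<phi> v i = \<phi> u i" by auto
    let ?w = "v \<oplus>\<^bsub>V\<^esub> (\<ominus>\<^bsub>V\<^esub> u)"
    have eq: "v = ?w \<oplus>\<^bsub>V\<^esub> u"
      using V.a_assoc[OF v(1) V.a_inv_closed[OF u] u] V.l_neg[OF u] V.r_zero[OF v(1)] by simp
    have wc: "?w \<in> carrier V" by (intro V.a_closed V.a_inv_closed u v(1))
    have "\<phi> ?w i = 0" if "i \<in> I" for i
      using add[OF wc u that, folded eq] v(2)[OF that] by simp
    then have "?w \<in> ?W" using wc by simp
    then show "v \<in> ?W +>\<^bsub>V\<^esub> u" using eq unfolding a_r_coset_def' by blast
  qed (use u in \<open>auto simp: a_r_coset_def' add\<close>)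
  obtain h where h: "bij_betw h {0..<card I} I"
    using ex_bij_betw_nat_finite[OF I] by blast
  let ?r = "the_inv_into {0..<card I} h"
  have hr: "?r i < card I" "h (?r i) = i" if "i \<in> I" for i
    using h that the_inv_into_into[of h "{0..<card I}" i "{0..<card I}"]
    by (auto simp: bij_betw_def f_the_inv_into_f)
  have rh: "?r (h j) = j" "h j \<in> I" if "j < card I" for j
    using h that by (auto simp: bij_betw_def the_inv_into_f_f)
  \<comment> \<open>A right inverse \<open>s\<close> of \<open>\<phi>\<close> is chosen pointwise.
    It need not be linear: only the coset of \<open>s x\<close> has to depend linearly on
    \<open>x\<close>, and that coset is fixed by the coordinates.\<close>
  have "\<exists>s. \<forall>x. s x \<in> carrier V \<and> (\<forall>i\<in>I. \<phi> (s x) i = x $ ?r i)"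
    using surj[of "\<lambda>i. _ $ ?r i"] by (intro choice) blast
  then obtain s where s: "\<And>x. s x \<in> carrier V" "\<And>x i. i \<in> I \<Longrightarrow> \<phi> (s x) i = x $ ?r i"
    by blast
  let ?T = "\<lambda>x. ?W +>\<^bsub>V\<^esub> s x"
  have T: "?T x = {v \<in> carrier V. \<forall>i\<in>I. \<phi> v i = x $ ?r i}" for x
    using s by (auto simp: coset)
  have C: "P \<in> carrier ?Q \<longleftrightarrow> (\<exists>v\<in>carrier V. P = ?W +>\<^bsub>V\<^esub> v)" for P
    by (auto simp: quotient_space_def A_RCOSETS_def')
  interpret N: vec_space "TYPE('a)" "card I" .
  have "?T \<in> LinearCombinations.module_hom class_ring N.V ?Q"
  proof -
    have "?T (x + y) = ?T x \<oplus>\<^bsub>?Q\<^esub> ?T y" if "x \<in> carrier_vec (card I)" "y \<in> carrier_vec (card I)" for x y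
    proof -
      have "?T x \<oplus>\<^bsub>?Q\<^esub> ?T y = ?W +>\<^bsub>V\<^esub> (s x \<oplus>\<^bsub>V\<^esub> s y)"
        using s by (simp add: quotient_space_def abelian_subgroup.a_rcos_sum[OF abW])
      also have "\<dots> = {v \<in> carrier V. \<forall>i\<in>I. \<phi> v i = (x + y) $ ?r i}"
        using s that hr by (subst coset) (auto simp: add)
      finally show ?thesis unfolding T by simp
    qed
    moreover have "?T (c \<cdot>\<^sub>v x) = c \<odot>\<^bsub>?Q\<^esub> ?T x" if "x \<in> carrier_vec (card I)" for c x
    proof -
      have "c \<odot>\<^bsub>?Q\<^esub> ?T x = ?W +>\<^bsub>V\<^esub> (c \<odot>\<^bsub>V\<^esub> s x)"
        using s V.smult_coset[OF W, of c "s x"] by (simp add: quotient_space_def)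
      also have "\<dots> = {v \<in> carrier V. \<forall>i\<in>I. \<phi> v i = (c \<cdot>\<^sub>v x) $ ?r i}"
        using s that hr by (subst coset) (auto simp: smult V.smult_closed)
      finally show ?thesis unfolding T by simp
    qed
    moreover have "?T x \<in> carrier ?Q" for x
      using s unfolding C by blast
    ultimately show ?thesis
      by (auto simp: LinearCombinations.module_hom_def module_vec_simps)
  qed
  then have T_lin: "linear_map class_ring N.V ?Q ?T"
    using Q N.module_axioms
    by (intro linear_map.intro mod_hom.intro mod_hom_axioms.intro N.vectorspace_axioms)
       (auto simp: vectorspace_def)
  have "inj_on ?T (carrier N.V)"
  proof (rule inj_onI)
    fix x y assume "x \<in> carrier N.V" "y \<in> carrier N.V" and eq: "?T x = ?T y"
    then have xy: "x \<in> carrier_vec (card I)" "y \<in> carrier_vec (card I)"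
      by (simp_all add: module_vec_simps)
    have "s x \<in> ?T x" unfolding T using s by auto
    then have "s x \<in> ?T y" unfolding eq .
    then have "x $ ?r i = y $ ?r i" if "i \<in> I" for i
      using s that by (simp add: T)
    then have "x $ j = y $ j" if "j < card I" for j using rh[OF that] by metis
    then show "x = y" using xy by auto
  qed
  moreover have "?T ` carrier N.V = carrier ?Q"
  proof (intro equalityI subsetI)
    fix P assume "P \<in> carrier ?Q"
    then obtain v where v: "v \<in> carrier V" "P = ?W +>\<^bsub>V\<^esub> v" by (auto simp: C)
    have "?T (vec (card I) (\<lambda>j. \<phi> v (h j))) = P"
      unfolding T using v hr by (auto simp: coset)
    then show "P \<in> ?T ` carrier N.V" by (auto simp: module_vec_simps intro!: image_eqI)
  qed (use s in \<open>auto simp: C\<close>)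
  ultimately have "N.dim = vectorspace.dim class_ring ?Q"
    by (intro linear_map.dim_eq[OF T_lin]) simp_all
  then show ?thesis by (simp add: N.dim_is_n)
qed

section \<open>Cochains of degree at most two\<close>

lemma cocycles_add:
  assumes "f \<in> cocycles L k" "g \<in> cocycles L k"
  shows "(\<lambda>zs. f zs + g zs) \<in> cocycles L k"
proof -
  have "ce_differential L k (\<lambda>zs. f zs + g zs) = (\<lambda>zs. ce_differential L k f zs + ce_differential L k g zs)"
    by (auto simp: ce_differential_def sum.distrib algebra_simps)
  with assms show ?thesis
    by (auto simp: cocycles_def cochains_def multilinear_form_def skew_symmetric_form_def algebra_simps)
qed

lemma cocycles_smult:
  assumes "f \<in> cocycles L k"
  shows "(\<lambda>zs. c * f zs) \<in> cocycles L k"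
proof -
  have "ce_differential L k (\<lambda>zs. c * f zs) = (\<lambda>zs. c * ce_differential L k f zs)"
    by (auto simp: ce_differential_def sum_distrib_left algebra_simps)
  with assms show ?thesis
    by (auto simp: cocycles_def cochains_def multilinear_form_def skew_symmetric_form_def algebra_simps)
qed

lemma vectorspace_cocycle_space: "vectorspace class_ring (cocycle_space L k)"
proof -
  let ?Z = "cocycle_space L k"
  have zero: "(\<lambda>_. 0) \<in> cocycles L k"
    by (auto simp: cocycles_def cochains_def multilinear_form_def skew_symmetric_form_def ce_differential_def)
  have "\<exists>y\<in>carrier ?Z. y \<oplus>\<^bsub>?Z\<^esub> x = \<zero>\<^bsub>?Z\<^esub>" if "x \<in> carrier ?Z" for x
    using cocycles_smult[of x L k "-1"] that by (intro bexI[of _ "\<lambda>zs. - x zs"]) (auto simp: cocycle_space_def)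
  then have "Module.module class_ring ?Z"
    by (intro Module.moduleI abelian_groupI class_cring.cring_axioms)
       (auto simp: cocycle_space_def algebra_simps zero cocycles_add cocycles_smult)
  then show ?thesis
    by (simp add: vectorspace_def class_field.field_axioms)
qed

section \<open>Forms evaluated on one or two arguments, and their differentials\<close>

lemma cochain_add:
  assumes "f \<in> cochains L 2" "u \<in> carrier L" "v \<in> carrier L" "w \<in> carrier L"
  shows "f [u \<oplus>\<^bsub>L\<^esub> v, w] = f [u, w] + f [v, w]" "f [w, u \<oplus>\<^bsub>L\<^esub> v] = f [w, u] + f [w, v]"
proof -
  have "\<forall>zs i u v. length zs = 2 \<and> set zs \<subseteq> carrier L \<and> i < 2 \<and> u \<in> carrier L \<and> v \<in> carrier L
        \<longrightarrow> f (zs[i := u \<oplus>\<^bsub>L\<^esub> v]) = f (zs[i := u]) + f (zs[i := v])"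
    using assms(1) unfolding cochains_def multilinear_form_def by blast
  \<comment> \<open>One slot is overwritten and the other must hold \<open>w\<close>, so
    \<open>[w, w]\<close> serves both positions.\<close>
  note * = this[rule_format, of "[w, w]" _ u v]
  show "f [u \<oplus>\<^bsub>L\<^esub> v, w] = f [u, w] + f [v, w]" "f [w, u \<oplus>\<^bsub>L\<^esub> v] = f [w, u] + f [w, v]"
    using *[of 0] *[of 1] assms by simp_all
qed

lemma cochain_smult:
  assumes "f \<in> cochains L 2" "u \<in> carrier L" "w \<in> carrier L"
  shows "f [c \<odot>\<^bsub>L\<^esub> u, w] = c * f [u, w]" "f [w, c \<odot>\<^bsub>L\<^esub> u] = c * f [w, u]"
proof -
  have "\<forall>zs i u c. length zs = 2 \<and> set zs \<subseteq> carrier L \<and> i < 2 \<and> u \<in> carrier L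
        \<longrightarrow> f (zs[i := c \<odot>\<^bsub>L\<^esub> u]) = c * f (zs[i := u])"
    using assms(1) unfolding cochains_def multilinear_form_def by blast
  note * = this[rule_format, of "[w, w]" _ u c]
  show "f [c \<odot>\<^bsub>L\<^esub> u, w] = c * f [u, w]" "f [w, c \<odot>\<^bsub>L\<^esub> u] = c * f [w, u]"
    using *[of 0] *[of 1] assms by simp_all
qed

lemma cochain_skew:
  assumes "f \<in> cochains L 2" "u \<in> carrier L" "v \<in> carrier L"
  shows "f [v, u] = - f [u, v]"
proof -
  have "\<forall>zs i j. length zs = 2 \<and> set zs \<subseteq> carrier L \<and> i < j \<and> j < 2
        \<longrightarrow> f (zs[i := zs ! j, j := zs ! i]) = - f zs"
    using assms(1) by (simp add: cochains_def skew_symmetric_form_def)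
  from this[rule_format, of "[u, v]" 0 1] assms show ?thesis by simp
qed

lemma cochain_eqI:
  assumes "f \<in> cochains L 2" "g \<in> cochains L 2"
    and "\<And>u v. \<lbrakk>u \<in> carrier L; v \<in> carrier L\<rbrakk> \<Longrightarrow> f [u, v] = g [u, v]"
  shows "f = g"
proof
  fix zs
  show "f zs = g zs"
  proof (cases "length zs = 2 \<and> set zs \<subseteq> carrier L")
    case True
    then obtain u v where "zs = [u, v]" by (auto simp: numeral_2_eq_2 length_Suc_conv)
    with True assms(3) show ?thesis by simp
  next
    case False
    with assms(1,2) show ?thesis by (auto simp: cochains_def)
  qed
qed

text \<open>Linearity is asked for in the first argument only, since skew symmetry carries it over
  to the second. The default 0 off the pairs over the carrier is the one that
  \<open>cochains\<close> prescribes.\<close>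

lemma cochain_pairI:
  assumes "\<And>u v w. \<lbrakk>u \<in> carrier L; v \<in> carrier L; w \<in> carrier L\<rbrakk> \<Longrightarrow> \<phi> (u \<oplus>\<^bsub>L\<^esub> v) w = \<phi> u w + \<phi> v w"
    and "\<And>c u w. \<lbrakk>u \<in> carrier L; w \<in> carrier L\<rbrakk> \<Longrightarrow> \<phi> (c \<odot>\<^bsub>L\<^esub> u) w = c * \<phi> u w"
    and skew: "\<And>u v. \<lbrakk>u \<in> carrier L; v \<in> carrier L\<rbrakk> \<Longrightarrow> \<phi> v u = - \<phi> u v"
    and L: "vectorspace class_ring L"
  shows "(\<lambda>zs. if length zs = 2 \<and> set zs \<subseteq> carrier L then \<phi> (zs ! 0) (zs ! 1) else 0) \<in> cochains L 2"
proof -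
  interpret vectorspace class_ring L by (rule L)
  have sm: "c \<odot>\<^bsub>L\<^esub> u \<in> carrier L" if "u \<in> carrier L" for c u
    using that by (simp add: smult_closed)
  have r: "\<phi> w (u \<oplus>\<^bsub>L\<^esub> v) = \<phi> w u + \<phi> w v" "\<phi> w (c \<odot>\<^bsub>L\<^esub> u) = c * \<phi> w u"
    if "u \<in> carrier L" "v \<in> carrier L" "w \<in> carrier L" for u v w c
    using that assms(1)[of u v w] assms(2)[of u w c] skew[of u w] skew[of v w]
      skew[of "u \<oplus>\<^bsub>L\<^esub> v" w] skew[of "c \<odot>\<^bsub>L\<^esub> u" w] sm by auto
  have pair: "\<exists>p\<in>carrier L. \<exists>q\<in>carrier L. zs = [p, q]"
    if "length zs = 2" "set zs \<subseteq> carrier L" for zs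
    using that by (auto simp: numeral_2_eq_2 length_Suc_conv)
  let ?f = "\<lambda>zs. if length zs = 2 \<and> set zs \<subseteq> carrier L then \<phi> (zs ! 0) (zs ! 1) else 0"
  have "?f (zs[i := u \<oplus>\<^bsub>L\<^esub> v]) = ?f (zs[i := u]) + ?f (zs[i := v])"
    if zs: "length zs = 2" "set zs \<subseteq> carrier L" and i: "i < 2"
      and uv: "u \<in> carrier L" "v \<in> carrier L" for zs i u v
    using pair[OF zs] i uv assms(1) r(1) by (cases i) auto
  moreover have "?f (zs[i := c \<odot>\<^bsub>L\<^esub> u]) = c * ?f (zs[i := u])"
    if zs: "length zs = 2" "set zs \<subseteq> carrier L" and i: "i < 2" and u: "u \<in> carrier L" for zs i u c
    using pair[OF zs] i u assms(2) r(2) sm by (cases i) auto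
  moreover have "?f (zs[i := zs ! j, j := zs ! i]) = - ?f zs"
    if zs: "length zs = 2" "set zs \<subseteq> carrier L" and ij: "i < j" "j < 2" for zs i j
  proof -
    have "i = 0" "j = 1" using ij by auto
    moreover obtain p q where "p \<in> carrier L" "q \<in> carrier L" "zs = [p, q]"
      using pair[OF zs] by blast
    ultimately show ?thesis using skew[of p q] by simp
  qed
  ultimately show ?thesis
    unfolding cochains_def multilinear_form_def skew_symmetric_form_def mem_Collect_eq
    by (intro conjI allI impI) presburger+
qed

lemma cochain1_linear:
  assumes "g \<in> cochains L 1"
  shows "\<lbrakk>u \<in> carrier L; v \<in> carrier L\<rbrakk> \<Longrightarrow> g [u \<oplus>\<^bsub>L\<^esub> v] = g [u] + g [v]"
    and "u \<in> carrier L \<Longrightarrow> g [c \<odot>\<^bsub>L\<^esub> u] = c * g [u]"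
proof -
  have "\<forall>zs i u v. length zs = 1 \<and> set zs \<subseteq> carrier L \<and> i < 1 \<and> u \<in> carrier L \<and> v \<in> carrier L
        \<longrightarrow> g (zs[i := u \<oplus>\<^bsub>L\<^esub> v]) = g (zs[i := u]) + g (zs[i := v])"
    "\<forall>zs i u c. length zs = 1 \<and> set zs \<subseteq> carrier L \<and> i < 1 \<and> u \<in> carrier L
        \<longrightarrow> g (zs[i := c \<odot>\<^bsub>L\<^esub> u]) = c * g (zs[i := u])"
    using assms unfolding cochains_def multilinear_form_def by blast+
  from this(1)[rule_format, of "[u]" 0 u v] this(2)[rule_format, of "[u]" 0 u c]
  show "\<lbrakk>u \<in> carrier L; v \<in> carrier L\<rbrakk> \<Longrightarrow> g [u \<oplus>\<^bsub>L\<^esub> v] = g [u] + g [v]"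
    "u \<in> carrier L \<Longrightarrow> g [c \<odot>\<^bsub>L\<^esub> u] = c * g [u]" by simp_all
qed

lemma cochain1I:
  assumes "\<And>u v. \<lbrakk>u \<in> carrier L; v \<in> carrier L\<rbrakk> \<Longrightarrow> \<gamma> (u \<oplus>\<^bsub>L\<^esub> v) = \<gamma> u + \<gamma> v"
    and "\<And>c u. u \<in> carrier L \<Longrightarrow> \<gamma> (c \<odot>\<^bsub>L\<^esub> u) = c * \<gamma> u"
    and L: "vectorspace class_ring L"
  shows "(\<lambda>zs. if length zs = 1 \<and> set zs \<subseteq> carrier L then \<gamma> (zs ! 0) else 0) \<in> cochains L 1"
proof -
  interpret vectorspace class_ring L by (rule L)
  have sm: "c \<odot>\<^bsub>L\<^esub> u \<in> carrier L" if "u \<in> carrier L" for c u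
    using that by (simp add: smult_closed)
  show ?thesis
    unfolding cochains_def multilinear_form_def skew_symmetric_form_def
    using assms(1,2) sm by (auto simp: length_Suc_conv)
qed

text \<open>The double sum has the single term \<open>i = 0\<close>, \<open>j = 1\<close>, with sign
  -1, and no further argument is left over.\<close>

lemma ce_differential_1:
  "ce_differential L 1 g = (\<lambda>zs. if length zs = 2 \<and> set zs \<subseteq> carrier L
     then - g [lbracket L (zs ! 0) (zs ! 1)] else 0)"
proof
  fix zs
  have "nths [u, v] (- {0, Suc 0}) = []" for u v :: 'a
    by (simp add: nths_Cons)
  then show "ce_differential L 1 g zs = (if length zs = 2 \<and> set zs \<subseteq> carrier L
     then - g [lbracket L (zs ! 0) (zs ! 1)] else 0)"
    by (auto simp: ce_differential_def numeral_2_eq_2 length_Suc_conv)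
qed

text \<open>The index pairs (0,1), (0,2), (1,2) contribute with signs -, +, -.\<close>

lemma ce_differential_2:
  assumes "x \<in> carrier L" "y \<in> carrier L" "z \<in> carrier L"
  shows "ce_differential L 2 f [x, y, z] =
    - f [lbracket L x y, z] + f [lbracket L x z, y] - f [lbracket L y z, x]"
  using assms
  by (simp add: ce_differential_def numeral_2_eq_2 nths_Cons)

section \<open>Degree-two cocycles and coboundaries of a general Lie algebra\<close>

context complex_lie_algebra
begin

text \<open>Polarization of \<open>bracket_self\<close> at \<open>x \<oplus> y\<close>.\<close>

lemma bracket_skew:
  assumes x: "x \<in> carrier L" and y: "y \<in> carrier L"
  shows "lbracket L y x = (- 1) \<odot> lbracket L x y"
proof -
  interpret vectorspace class_ring L by (rule vs)
  note cl = bracket_closed[OF x y] bracket_closed[OF y x]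
  have "lbracket L (x \<oplus> y) (x \<oplus> y) = lbracket L y x \<oplus> lbracket L x y"
    using x y cl by (simp add: bracket_add bracket_closed bracket_self[OF x] bracket_self[OF y] a_comm)
  then have "lbracket L y x \<oplus> lbracket L x y = \<zero>"
    using bracket_self[of "x \<oplus> y"] x y by simp
  then have "lbracket L y x = \<ominus> lbracket L x y"
    using minus_equality[of "lbracket L y x" "lbracket L x y"] cl by simp
  then show ?thesis
    using smult_minus_1[OF cl(1)] by (simp add: class_ring_simps)
qed

text \<open>Replacing the bracket of \<open>x\<close> and \<open>z\<close> by minus that of
  \<open>z\<close> and \<open>x\<close> turns the differential into minus a cyclic sum. Only triples
  over the carrier need checking, because the differential is 0 on all other lists by
  definition.\<close>

lemma cocycle_iff:
  "f \<in> cocycles L 2 \<longleftrightarrow> f \<in> cochains L 2 \<and>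
     (\<forall>x\<in>carrier L. \<forall>y\<in>carrier L. \<forall>z\<in>carrier L.
        f [lbracket L x y, z] + f [lbracket L y z, x] + f [lbracket L z x, y] = 0)"
proof -
  have eq: "ce_differential L 2 f [x, y, z] =
      - (f [lbracket L x y, z] + f [lbracket L y z, x] + f [lbracket L z x, y])"
    if f: "f \<in> cochains L 2" and xyz: "x \<in> carrier L" "y \<in> carrier L" "z \<in> carrier L" for x y z
    using xyz bracket_skew[of z x] cochain_smult(1)[OF f, of "lbracket L z x" y "-1"]
    by (simp add: ce_differential_2 bracket_closed)
  have "ce_differential L 2 f = (\<lambda>_. 0) \<longleftrightarrow> (\<forall>x\<in>carrier L. \<forall>y\<in>carrier L. \<forall>z\<in>carrier L.
        f [lbracket L x y, z] + f [lbracket L y z, x] + f [lbracket L z x, y] = 0)" (is "?l \<longleftrightarrow> ?r")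
    if f: "f \<in> cochains L 2"
  proof
    assume ?l
    then show ?r using eq[OF f] by (metis neg_equal_0_iff_equal)
  next
    assume r: ?r
    show ?l
    proof
      fix zs
      show "ce_differential L 2 f zs = 0"
      proof (cases "length zs = Suc 2 \<and> set zs \<subseteq> carrier L")
        case True
        then obtain x y z where "zs = [x, y, z]" by (auto simp: numeral_2_eq_2 length_Suc_conv)
        with True r eq[OF f] show ?thesis by simp
      next
        case False
        then show ?thesis unfolding ce_differential_def by (rule if_not_P)
      qed
    qed
  qed
  then show ?thesis by (auto simp: cocycles_def)
qed

text \<open>The cyclic sum for the differential of \<open>g\<close> is, up to sign, \<open>g\<close>
  applied to the Jacobi identity.\<close>

lemma coboundary_cocycle:
  assumes g: "g \<in> cochains L 1"
  shows "ce_differential L 1 g \<in> cocycles L 2"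
proof -
  interpret vectorspace class_ring L by (rule vs)
  note lin = cochain1_linear[OF g]
  have g_skew: "g [lbracket L v u] = - g [lbracket L u v]" if "u \<in> carrier L" "v \<in> carrier L" for u v
    using lin(2)[OF bracket_closed[OF that], of "-1"] bracket_skew[OF that] by simp
  have "ce_differential L 1 g \<in> cochains L 2"
    unfolding ce_differential_1
  proof (rule cochain_pairI[OF _ _ _ vs])
    fix u v w c assume uvw: "u \<in> carrier L" "v \<in> carrier L"
    show "- g [lbracket L v u] = - (- g [lbracket L u v])"
      using g_skew[OF uvw] by simp
    show "- g [lbracket L (c \<odot> u) v] = c * - g [lbracket L u v]"
      using uvw by (simp add: bracket_smult bracket_closed lin)
    assume "w \<in> carrier L"
    with uvw show "- g [lbracket L (u \<oplus> v) w] = - g [lbracket L u w] + - g [lbracket L v w]"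
      by (simp add: bracket_add bracket_closed lin)
  qed
  moreover
  have "g [lbracket L (lbracket L x y) z] + g [lbracket L (lbracket L y z) x]
      + g [lbracket L (lbracket L z x) y] = 0"
    if xyz: "x \<in> carrier L" "y \<in> carrier L" "z \<in> carrier L" for x y z
  proof -
    have "g [\<zero>] = 0" using lin(2)[of \<zero> 0] by simp
    then have "g [lbracket L x (lbracket L y z) \<oplus> lbracket L y (lbracket L z x)
        \<oplus> lbracket L z (lbracket L x y)] = 0"
      by (simp only: jacobi[OF xyz])
    then have "g [lbracket L x (lbracket L y z)]
        + g [lbracket L y (lbracket L z x)] + g [lbracket L z (lbracket L x y)] = 0"
      using xyz by (simp add: lin bracket_closed)
    \<comment> \<open>The cocycle identity nests brackets on the left, \<open>jacobi\<close> on the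
      right; each exchange costs a sign.\<close>
    moreover have "g [lbracket L (lbracket L x y) z] = - g [lbracket L z (lbracket L x y)]"
      "g [lbracket L (lbracket L y z) x] = - g [lbracket L x (lbracket L y z)]"
      "g [lbracket L (lbracket L z x) y] = - g [lbracket L y (lbracket L z x)]"
      by (rule g_skew; simp add: bracket_closed xyz)+
    moreover have "- c + - a + - b = - (a + b + c)" for a b c :: complex by simp
    ultimately show ?thesis by (simp only: neg_equal_0_iff_equal)
  qed
  then have "- g [lbracket L (lbracket L x y) z] + - g [lbracket L (lbracket L y z) x]
      + - g [lbracket L (lbracket L z x) y] = 0"
    if "x \<in> carrier L" "y \<in> carrier L" "z \<in> carrier L" for x y z
    using that by (simp only: minus_add_distrib[symmetric] neg_equal_0_iff_equal)
  ultimately show ?thesis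
    unfolding cocycle_iff ce_differential_1 by (simp add: bracket_closed)
qed

end

section \<open>Weights of the diamond Lie algebra\<close>

lemma diamond_simps [simp]:
  "\<zero>\<^bsub>diamond n \<Lambda>\<^esub> = (\<lambda>_. 0)"
  "u \<oplus>\<^bsub>diamond n \<Lambda>\<^esub> v = (\<lambda>b. u b + v b)"
  "c \<odot>\<^bsub>diamond n \<Lambda>\<^esub> u = (\<lambda>b. c * u b)"
  by (simp_all add: diamond_def)

lemma diamond_carrier: "carrier (diamond n \<Lambda>) = {v. \<forall>b. b \<notin> diamond_indices n \<longrightarrow> v b = 0}"
  by (simp add: diamond_def)

lemma finite_diamond_indices [simp]: "finite (diamond_indices n)"
  by (simp add: diamond_indices_def)

lemma basis_vec_carrier [simp]: "b \<in> diamond_indices n \<Longrightarrow> basis_vec b \<in> carrier (diamond n \<Lambda>)"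
  by (auto simp: diamond_carrier basis_vec_def)

text \<open>Induction over a set \<open>S\<close> of basis indices, applied to the truncation of
  \<open>v\<close> to \<open>S\<close>. A vector of the carrier is its own truncation to
  \<open>diamond_indices n\<close>.\<close>

lemma diamond_linear_expand:
  assumes add: "\<And>u v. \<lbrakk>u \<in> carrier (diamond n \<Lambda>); v \<in> carrier (diamond n \<Lambda>)\<rbrakk> \<Longrightarrow> F (\<lambda>b. u b + v b) = F u + F v"
    and smult: "\<And>c u. u \<in> carrier (diamond n \<Lambda>) \<Longrightarrow> F (\<lambda>b. c * u b) = c * F u"
    and v: "v \<in> carrier (diamond n \<Lambda>)"
  shows "F v = (\<Sum>b\<in>diamond_indices n. v b * (F (basis_vec b) :: complex))"
proof -
  have "F (\<lambda>b. if b \<in> S then v b else 0) = (\<Sum>b\<in>S. v b * F (basis_vec b))"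
    if "finite S" "S \<subseteq> diamond_indices n" for S
    using that
  proof (induction S)
    case empty
    show ?case using smult[of "\<lambda>_. 0" 0] by (simp add: diamond_carrier)
  next
    case (insert s S)
    have "(\<lambda>b. if b \<in> insert s S then v b else 0) =
        (\<lambda>b. (\<lambda>b. v s * basis_vec s b) b + (\<lambda>b. if b \<in> S then v b else 0) b)"
      using insert.hyps by (auto simp: basis_vec_def)
    moreover have "(\<lambda>b. v s * basis_vec s b) \<in> carrier (diamond n \<Lambda>)"
      "(\<lambda>b. if b \<in> S then v b else 0) \<in> carrier (diamond n \<Lambda>)"
      using insert.prems by (auto simp: diamond_carrier basis_vec_def)
    ultimately have "F (\<lambda>b. if b \<in> insert s S then v b else 0) =
        F (\<lambda>b. v s * basis_vec s b) + F (\<lambda>b. if b \<in> S then v b else 0)"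
      by (simp only: add)
    then show ?case using insert by (simp add: smult)
  qed
  moreover have "(\<lambda>b. if b \<in> diamond_indices n then v b else 0) = v"
    using v by (auto simp: diamond_carrier)
  ultimately show ?thesis
    using finite_diamond_indices by (metis order_refl)
qed

text \<open>The two arguments are expanded in the basis one after the other.\<close>

lemma diamond_cochain_zero:
  assumes f: "f \<in> cochains (diamond n \<Lambda>) 2"
    and 0: "\<And>a b. \<lbrakk>a \<in> diamond_indices n; b \<in> diamond_indices n\<rbrakk> \<Longrightarrow> f [basis_vec a, basis_vec b] = 0"
  shows "f = (\<lambda>_. 0)"
proof (rule cochain_eqI[OF f])
  show "(\<lambda>_. 0) \<in> cochains (diamond n \<Lambda>) 2"
    by (auto simp: cochains_def multilinear_form_def skew_symmetric_form_def)
  note lin = cochain_add[OF f, simplified] cochain_smult[OF f, simplified]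
  fix u v assume u: "u \<in> carrier (diamond n \<Lambda>)" and v: "v \<in> carrier (diamond n \<Lambda>)"
  have "f [basis_vec a, v] = 0" if "a \<in> diamond_indices n" for a
    using diamond_linear_expand[where F = "\<lambda>v. f [basis_vec a, v]", OF _ _ v] that
    by (simp add: lin 0)
  then show "f [u, v] = 0"
    using diamond_linear_expand[where F = "\<lambda>u. f [u, v]", OF _ _ u] v
    by (simp add: lin)
qed

text \<open>A choice of signs under which no two of the values are opposite, so that values agreeing
  up to sign agree outright. The case \<open>i = j\<close> of the last assumption makes every
  \<open>\<mu> i\<close> nonzero.\<close>

locale signed_diamond =
  fixes n :: nat and \<Lambda> \<mu> :: "nat \<Rightarrow> complex"
  assumes n: "n \<ge> 1"
    and \<mu>: "i \<in> {1..n} \<Longrightarrow> \<mu> i = \<Lambda> i \<or> \<mu> i = - \<Lambda> i"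
    and \<mu>_sum: "\<lbrakk>i \<in> {1..n}; j \<in> {1..n}\<rbrakk> \<Longrightarrow> \<mu> i + \<mu> j \<noteq> 0"
begin

abbreviation "L \<equiv> diamond n \<Lambda>"

definition pos :: "nat \<Rightarrow> diamond_basis" where "pos i = (if \<mu> i = \<Lambda> i then BX i else BY i)"

definition neg :: "nat \<Rightarrow> diamond_basis" where "neg i = (if \<mu> i = \<Lambda> i then BY i else BX i)"

sublocale complex_lie_algebra L
  using diamond_quadratic_lie_algebra by (rule complex_quadratic_lie_algebra.axioms)

lemma \<mu>_nonzero: "i \<in> {1..n} \<Longrightarrow> \<mu> i \<noteq> 0"
  using \<mu>_sum[of i i] by auto

lemma pos_neg_eq_iff [simp]:
  "pos i = pos j \<longleftrightarrow> i = j" "neg i = neg j \<longleftrightarrow> i = j" "pos i \<noteq> neg j" "neg i \<noteq> pos j"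
  "i \<ge> 1 \<Longrightarrow> pos i \<noteq> BX 0" "i \<ge> 1 \<Longrightarrow> pos i \<noteq> BY 0"
  "i \<ge> 1 \<Longrightarrow> neg i \<noteq> BX 0" "i \<ge> 1 \<Longrightarrow> neg i \<noteq> BY 0"
  by (auto simp: pos_def neg_def)

lemma pos_neg_index [simp]:
  "i \<in> {1..n} \<Longrightarrow> pos i \<in> diamond_indices n" "i \<in> {1..n} \<Longrightarrow> neg i \<in> diamond_indices n"
  "BX 0 \<in> diamond_indices n" "BY 0 \<in> diamond_indices n"
  by (auto simp: pos_def neg_def diamond_indices_def)

lemma index_cases:
  assumes "b \<in> diamond_indices n"
  obtains "b = BX 0" | "b = BY 0" | i where "i \<in> {1..n}" "b = pos i" | i where "i \<in> {1..n}" "b = neg i"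
proof -
  from assms obtain i where i: "i \<le> n" "b = BX i \<or> b = BY i"
    by (auto simp: diamond_indices_def)
  then have "b = pos i \<or> b = neg i" by (auto simp: pos_def neg_def)
  with i that show ?thesis
    by (cases "i = 0") (auto simp: Suc_le_eq)
qed

lemma bracket_coord:
  assumes i: "i \<in> {1..n}"
  shows "lbracket L u v (pos i) = \<mu> i * (u (BY 0) * v (pos i) - u (pos i) * v (BY 0))"
    and "lbracket L u v (neg i) = - \<mu> i * (u (BY 0) * v (neg i) - u (neg i) * v (BY 0))"
proof -
  obtain m where "i = Suc m" "m < n" using i by (cases i) auto
  then show "lbracket L u v (pos i) = \<mu> i * (u (BY 0) * v (pos i) - u (pos i) * v (BY 0))"
    "lbracket L u v (neg i) = - \<mu> i * (u (BY 0) * v (neg i) - u (neg i) * v (BY 0))"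
    using \<mu>[OF i] by (auto simp: pos_def neg_def diamond_bracket_coords)
qed

text \<open>The defining relations keep their form when \<open>\<Lambda> i\<close> changes sign and
  \<open>BX i\<close>, \<open>BY i\<close> are exchanged, with \<open>pos i\<close> before
  \<open>neg i\<close> in the bracket giving \<open>BX 0\<close>. Hence both choices of sign yield
  the same formulas.\<close>

lemma bracket_basis:
  assumes i: "i \<in> {1..n}"
  shows "lbracket L (basis_vec (BY 0)) (basis_vec (pos i)) = (\<lambda>b. \<mu> i * basis_vec (pos i) b)"
    and "lbracket L (basis_vec (BY 0)) (basis_vec (neg i)) = (\<lambda>b. - \<mu> i * basis_vec (neg i) b)"
    and "lbracket L (basis_vec (pos i)) (basis_vec (BY 0)) = (\<lambda>b. - \<mu> i * basis_vec (pos i) b)"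
    and "lbracket L (basis_vec (neg i)) (basis_vec (BY 0)) = (\<lambda>b. \<mu> i * basis_vec (neg i) b)"
    and "lbracket L (basis_vec (BX 0)) (basis_vec (pos i)) = (\<lambda>_. 0)"
    and "lbracket L (basis_vec (BX 0)) (basis_vec (neg i)) = (\<lambda>_. 0)"
    and "j \<in> {1..n} \<Longrightarrow> lbracket L (basis_vec (pos i)) (basis_vec (neg j)) =
      (if i = j then (\<lambda>b. \<mu> i * basis_vec (BX 0) b) else (\<lambda>_. 0))"
    and "j \<in> {1..n} \<Longrightarrow> lbracket L (basis_vec (pos i)) (basis_vec (pos j)) = (\<lambda>_. 0)"
    and "j \<in> {1..n} \<Longrightarrow> lbracket L (basis_vec (neg i)) (basis_vec (neg j)) = (\<lambda>_. 0)"
  using i \<mu>[of i] \<mu>[of j]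
  by (simp_all add: diamond_bracket_basis) (auto simp: pos_def neg_def)

lemma bracket_center:
  "lbracket L (basis_vec (BY 0)) (basis_vec (BX 0)) = (\<lambda>_. 0)"
  by (simp add: diamond_bracket_basis)

text \<open>On a triple (\<open>BY 0\<close>, \<open>a\<close>, \<open>b\<close>) with
  \<open>a\<close>, \<open>b\<close> of weights \<open>r\<close>, \<open>s\<close> under the bracket
  with \<open>BY 0\<close>, the cocycle identity reads
  \<open>(r + s) * f [a, b] + f [[a, b], BY 0] = 0\<close>. So \<open>f\<close> vanishes on
  commuting \<open>a\<close>, \<open>b\<close> whose weights do not cancel.\<close>

lemma cocycle_values:
  assumes f: "f \<in> cocycles L 2" and i: "i \<in> {1..n}" and j: "j \<in> {1..n}"
  shows "f [basis_vec (BX 0), basis_vec (BY 0)] = 0"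
    and "f [basis_vec (BX 0), basis_vec (pos i)] = 0"
    and "f [basis_vec (BX 0), basis_vec (neg i)] = 0"
    and "f [basis_vec (pos i), basis_vec (pos j)] = 0"
    and "f [basis_vec (neg i), basis_vec (neg j)] = 0"
    and "\<mu> i \<noteq> \<mu> j \<Longrightarrow> f [basis_vec (pos i), basis_vec (neg j)] = 0"
proof -
  have fc: "f \<in> cochains L 2" using f by (simp add: cocycles_def)
  have cyc: "f [lbracket L x y, z] + f [lbracket L y z, x] + f [lbracket L z x, y] = 0"
    if "x \<in> carrier L" "y \<in> carrier L" "z \<in> carrier L" for x y z
    using f that by (simp add: cocycle_iff)
  have sm: "f [\<lambda>b. c * u b, w] = c * f [u, w]" if "u \<in> carrier L" "w \<in> carrier L" for c u w
    using cochain_smult(1)[OF fc that, of c] by simp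
  have sm': "f [\<lambda>b. - (c * u b), w] = - (c * f [u, w])" if "u \<in> carrier L" "w \<in> carrier L" for c u w
    using sm[OF that, of "-c"] by simp
  have z: "f [\<lambda>_. 0, w] = 0" if "w \<in> carrier L" for w
    using sm[of "\<lambda>_. 0" w 0] that by (simp add: diamond_carrier)
  note s = bracket_basis bracket_center sm sm' z
  note sk = cochain_skew[OF fc, of "basis_vec _" "basis_vec _"]
  let ?e = basis_vec
  \<comment> \<open>Here the weights of \<open>pos i\<close> and \<open>neg i\<close> cancel, and
    only their bracket, \<open>\<mu> i\<close> times \<open>BX 0\<close>, survives.\<close>
  show "f [?e (BX 0), ?e (BY 0)] = 0"
    using cyc[of "?e (BY 0)" "?e (pos i)" "?e (neg i)"] sk[of "neg i" "pos i"] i \<mu>_nonzero[OF i]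
    by (simp add: s algebra_simps)
  show "f [?e (BX 0), ?e (pos i)] = 0"
    using cyc[of "?e (BY 0)" "?e (BX 0)" "?e (pos i)"] sk[of "BX 0" "pos i"] i \<mu>_nonzero[OF i]
    by (simp add: s)
  show "f [?e (BX 0), ?e (neg i)] = 0"
    using cyc[of "?e (BY 0)" "?e (BX 0)" "?e (neg i)"] sk[of "BX 0" "neg i"] i \<mu>_nonzero[OF i]
    by (simp add: s)
  have "(\<mu> i + \<mu> j) * f [?e (pos i), ?e (pos j)] = 0"
    using cyc[of "?e (BY 0)" "?e (pos i)" "?e (pos j)"] sk[of "pos i" "pos j"] i j
    by (simp add: s algebra_simps)
  then show "f [?e (pos i), ?e (pos j)] = 0" using \<mu>_sum[OF i j] by simp
  have "(\<mu> i + \<mu> j) * f [?e (neg i), ?e (neg j)] = 0"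
    using cyc[of "?e (BY 0)" "?e (neg i)" "?e (neg j)"] sk[of "neg i" "neg j"] i j
    by (simp add: s algebra_simps neg_eq_iff_add_eq_0)
  then show "f [?e (neg i), ?e (neg j)] = 0" using \<mu>_sum[OF i j] by simp
  assume ne: "\<mu> i \<noteq> \<mu> j"
  \<comment> \<open>For distinct indices \<open>pos i\<close> and \<open>neg j\<close> commute,
    leaving only the term with the weights \<open>\<mu> i\<close> and
    \<open>- \<mu> j\<close>.\<close>
  then have "i \<noteq> j" by blast
  then have "(\<mu> i - \<mu> j) * f [?e (pos i), ?e (neg j)] = 0"
    using cyc[of "?e (BY 0)" "?e (pos i)" "?e (neg j)"] sk[of "pos i" "neg j"] i j
    by (auto simp: s algebra_simps)
  with ne show "f [?e (pos i), ?e (neg j)] = 0" by simp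
qed

text \<open>By \<open>cocycle_values\<close> and skew symmetry, these are the only pairs of basis
  vectors on which a cocycle can be nonzero. The lemma serves to compare two cocycles through their
  difference.\<close>

lemma cocycle_zeroI:
  assumes f: "f \<in> cocycles L 2"
    and 1: "\<And>i. i \<in> {1..n} \<Longrightarrow> f [basis_vec (BY 0), basis_vec (pos i)] = 0"
      "\<And>i. i \<in> {1..n} \<Longrightarrow> f [basis_vec (BY 0), basis_vec (neg i)] = 0"
    and 2: "\<And>i j. \<lbrakk>i \<in> {1..n}; j \<in> {1..n}; \<mu> i = \<mu> j\<rbrakk> \<Longrightarrow> f [basis_vec (pos i), basis_vec (neg j)] = 0"
  shows "f = (\<lambda>_. 0)"
proof -
  have fc: "f \<in> cochains L 2" using f by (simp add: cocycles_def)
  let ?e = basis_vec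
  have sym: "f [?e a, ?e b] = 0"
    if "f [?e b, ?e a] = 0" "a \<in> diamond_indices n" "b \<in> diamond_indices n" for a b
    using cochain_skew[OF fc, of "?e b" "?e a"] that by simp
  have self: "f [?e a, ?e a] = 0" if "a \<in> diamond_indices n" for a
    using cochain_skew[OF fc, of "?e a" "?e a"] that by simp
  \<comment> \<open>Vanishing on (\<open>BX 0\<close>, \<open>BY 0\<close>) was derived from some
    pair \<open>pos i\<close>, \<open>neg i\<close>, which exists because
    \<open>n \<ge> 1\<close>.\<close>
  have 11: "1 \<in> {1..n}" using n by simp
  note v = cocycle_values[OF f] cocycle_values(1)[OF f 11 11]
  have v6: "f [?e (pos i), ?e (neg j)] = 0" if "i \<in> {1..n}" "j \<in> {1..n}" for i j
    using 2[OF that] v(6)[OF that] by blast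
  show ?thesis
  proof (rule diamond_cochain_zero[OF fc])
    fix a b assume ab: "a \<in> diamond_indices n" "b \<in> diamond_indices n"
    show "f [?e a, ?e b] = 0"
      by (rule index_cases[OF ab(1)]; rule index_cases[OF ab(2)];
          insert v(2)[OF _ 11] v(3)[OF _ 11] v(4,5,7) v6 1 self sym ab; metis)
  qed
qed

end

section \<open>The second cohomology of the diamond Lie algebra\<close>

context signed_diamond
begin

text \<open>Index set of the coordinates on cohomology. The pair \<open>(1, 1)\<close> is left out
  because the value there can be normalized to 0 by a coboundary; this is the -1 of the Betti
  number.\<close>

definition pairs :: "(nat \<times> nat) set" where
  "pairs = {(i, j) \<in> {1..n} \<times> {1..n}. \<mu> i = \<mu> j} - {(1, 1)}"

text \<open>The 2-coboundaries take proportional values \<open>\<mu> i * t\<close> on the pairs \<open>(pos i, neg i)\<close>;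
  subtracting the multiple of \<open>(\<mu> i)\<^sub>i\<close> that agrees at \<open>i = 1\<close> kills them.\<close>

definition coord :: "(diamond_vec list \<Rightarrow> complex) \<Rightarrow> nat \<times> nat \<Rightarrow> complex" where
  "coord f = (\<lambda>(i, j). f [basis_vec (pos i), basis_vec (neg j)] -
     (if i = j then \<mu> i / \<mu> 1 * f [basis_vec (pos 1), basis_vec (neg 1)] else 0))"

lemma one_mem: "1 \<in> {1..n}"
  using n by simp

lemma finite_pairs: "finite pairs"
proof -
  have "pairs \<subseteq> {1..n} \<times> {1..n}" by (auto simp: pairs_def)
  then show ?thesis by (rule finite_subset) simp
qed

lemma coord_coboundary:
  assumes g: "g \<in> cochains L 1" and p: "p \<in> pairs"
  shows "coord (ce_differential L 1 g) p = 0"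
proof -
  obtain i j where ij: "p = (i, j)" "i \<in> {1..n}" "j \<in> {1..n}"
    using p by (auto simp: pairs_def)
  have "g [\<lambda>b. c * basis_vec (BX 0) b] = c * g [basis_vec (BX 0)]" for c
    using cochain1_linear(2)[OF g, of "basis_vec (BX 0)" c] by simp
  moreover from this[of 0] have "g [\<lambda>_. 0] = 0" by simp
  \<comment> \<open>The factor in front of \<open>\<mu> i\<close> is the same for all
    \<open>i\<close>, so the correction term of \<open>coord\<close> cancels it.\<close>
  ultimately have "ce_differential L 1 g [basis_vec (pos i), basis_vec (neg j)] =
      (if i = j then - \<mu> i * g [basis_vec (BX 0)] else 0)"
    if "i \<in> {1..n}" "j \<in> {1..n}" for i j
    unfolding ce_differential_1 using that by (simp add: bracket_basis)
  then show ?thesis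
    using ij one_mem \<mu>_nonzero[OF one_mem] by (simp add: coord_def)
qed

text \<open>A linear form \<open>\<gamma>\<close> is prescribed on the basis so that its
  differential agrees with \<open>f\<close> on all pairs where a cocycle is free;
  \<open>cocycle_zeroI\<close> then gives equality.\<close>

lemma cocycle_coboundaryI:
  assumes f: "f \<in> cocycles L 2" and 0: "\<And>p. p \<in> pairs \<Longrightarrow> coord f p = 0"
  shows "\<exists>g\<in>cochains L 1. f = ce_differential L 1 g"
proof -
  let ?e = basis_vec
  define t where "t = f [?e (pos 1), ?e (neg 1)] / \<mu> 1"
  \<comment> \<open>Obtained by solving \<open>- \<gamma> [a, b] = f [a, b]\<close>: the pairs with
    \<open>BY 0\<close> fix \<open>\<gamma>\<close> on \<open>pos i\<close> and
    \<open>neg i\<close>, and the pair (\<open>pos 1\<close>, \<open>neg 1\<close>) makes it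
    \<open>- t\<close> on \<open>BX 0\<close>. Brackets have no component along \<open>BY 0\<close>,
    where \<open>\<gamma>\<close> is put to 0.\<close>
  define \<gamma> where "\<gamma> v = - (\<Sum>i\<in>{1..n}. (v (pos i) * f [?e (BY 0), ?e (pos i)]
      - v (neg i) * f [?e (BY 0), ?e (neg i)]) / \<mu> i) - v (BX 0) * t" for v
  let ?g = "\<lambda>zs. if length zs = 1 \<and> set zs \<subseteq> carrier L then \<gamma> (zs ! 0) else 0"
  have g: "?g \<in> cochains L 1"
    by (rule cochain1I[OF _ _ diamond_vectorspace])
       (simp_all add: \<gamma>_def algebra_simps sum.distrib sum_subtractf diff_divide_distrib
         add_divide_distrib sum_distrib_left)
  let ?h = "ce_differential L 1 ?g"
  have h: "?h \<in> cocycles L 2" by (rule coboundary_cocycle[OF g])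
  have h_val: "?h [?e a, ?e b] = - \<gamma> (lbracket L (?e a) (?e b))"
    if "a \<in> diamond_indices n" "b \<in> diamond_indices n" for a b
    unfolding ce_differential_1 using that by (simp add: bracket_closed)
  have \<gamma>_pos: "\<gamma> (\<lambda>b. c * ?e (pos i) b) = - c * f [?e (BY 0), ?e (pos i)] / \<mu> i"
    and \<gamma>_neg: "\<gamma> (\<lambda>b. c * ?e (neg i) b) = c * f [?e (BY 0), ?e (neg i)] / \<mu> i"
    if "i \<in> {1..n}" for c i
  proof -
    have ne: "BX 0 \<noteq> pos i" "BX 0 \<noteq> neg i"
      using that by (auto simp: pos_def neg_def)
    have "(\<Sum>j\<in>{1..n}. (c * ?e (pos i) (pos j) * f [?e (BY 0), ?e (pos j)]
        - c * ?e (pos i) (neg j) * f [?e (BY 0), ?e (neg j)]) / \<mu> j) =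
        (\<Sum>j\<in>{1..n}. if j = i then c * f [?e (BY 0), ?e (pos j)] / \<mu> j else 0)"
      by (intro sum.cong) (auto simp: basis_vec_def)
    then show "\<gamma> (\<lambda>b. c * ?e (pos i) b) = - c * f [?e (BY 0), ?e (pos i)] / \<mu> i"
      using that ne by (simp add: \<gamma>_def) (simp add: basis_vec_def)
    have "(\<Sum>j\<in>{1..n}. (c * ?e (neg i) (pos j) * f [?e (BY 0), ?e (pos j)]
        - c * ?e (neg i) (neg j) * f [?e (BY 0), ?e (neg j)]) / \<mu> j) =
        (\<Sum>j\<in>{1..n}. if j = i then - c * f [?e (BY 0), ?e (neg j)] / \<mu> j else 0)"
      by (intro sum.cong) (auto simp: basis_vec_def)
    then show "\<gamma> (\<lambda>b. c * ?e (neg i) b) = c * f [?e (BY 0), ?e (neg i)] / \<mu> i"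
      using that ne by (simp add: \<gamma>_def) (simp add: basis_vec_def)
  qed
  have \<gamma>_X0: "\<gamma> (\<lambda>b. c * ?e (BX 0) b) = - c * t" for c
  proof -
    have "(\<Sum>j\<in>{1..n}. (c * ?e (BX 0) (pos j) * f [?e (BY 0), ?e (pos j)]
        - c * ?e (BX 0) (neg j) * f [?e (BY 0), ?e (neg j)]) / \<mu> j) = 0"
      by (intro sum.neutral) (auto simp: basis_vec_def)
    then show ?thesis by (simp add: \<gamma>_def) (simp add: basis_vec_def)
  qed
  have \<gamma>_0: "\<gamma> (\<lambda>_. 0) = 0" by (simp add: \<gamma>_def)
  \<comment> \<open>The vanishing of \<open>coord f\<close>, solved for \<open>f\<close>; at
    \<open>(1, 1)\<close>, which is not in \<open>pairs\<close>, it is the definition of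
    \<open>t\<close>.\<close>
  have f_val: "f [?e (pos i), ?e (neg j)] = (if i = j then \<mu> i * t else 0)"
    if "i \<in> {1..n}" "j \<in> {1..n}" "\<mu> i = \<mu> j" for i j
  proof (cases "(i, j) = (1, 1)")
    case True
    then show ?thesis using \<mu>_nonzero[OF one_mem] by (simp add: t_def)
  next
    case False
    with that have "(i, j) \<in> pairs" by (auto simp: pairs_def)
    from 0[OF this] show ?thesis by (auto simp: coord_def t_def split: if_splits)
  qed
  have "(\<lambda>zs. f zs + - 1 * ?h zs) \<in> cocycles L 2"
    by (intro cocycles_add cocycles_smult f h)
  then have "(\<lambda>zs. f zs + - 1 * ?h zs) = (\<lambda>_. 0)"
  proof (rule cocycle_zeroI)
    fix i j assume i: "i \<in> {1..n}"
    show "f [?e (BY 0), ?e (pos i)] + - 1 * ?h [?e (BY 0), ?e (pos i)] = 0"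
      using i \<mu>_nonzero[OF i] by (subst h_val) (simp_all only: bracket_basis \<gamma>_pos pos_neg_index, simp)
    show "f [?e (BY 0), ?e (neg i)] + - 1 * ?h [?e (BY 0), ?e (neg i)] = 0"
      using i \<mu>_nonzero[OF i] by (subst h_val) (simp_all only: bracket_basis \<gamma>_neg pos_neg_index, simp)
    assume j: "j \<in> {1..n}" "\<mu> i = \<mu> j"
    show "f [?e (pos i), ?e (neg j)] + - 1 * ?h [?e (pos i), ?e (neg j)] = 0"
      unfolding f_val[OF i j]
      using i j(1) by (subst h_val) (simp_all add: bracket_basis \<gamma>_X0 \<gamma>_0)
  qed
  then have "f = ?h" by (auto simp: fun_eq_iff)
  with g show ?thesis by blast
qed

text \<open>Brings the coboundaries into the form of a common kernel, as
  \<open>dim_quotient_space_kernel\<close> requires.\<close>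

lemma coboundaries_eq: "coboundaries L 2 = {f \<in> cocycles L 2. \<forall>p\<in>pairs. coord f p = 0}"
proof -
  have "coboundaries L 2 = ce_differential L 1 ` cochains L 1"
    by (simp add: coboundaries_def numeral_2_eq_2)
  moreover have "\<dots> = {f \<in> cocycles L 2. \<forall>p\<in>pairs. coord f p = 0}"
    using coboundary_cocycle coord_coboundary cocycle_coboundaryI by blast
  ultimately show ?thesis by simp
qed

text \<open>The witness is the combination, with coefficients \<open>c\<close>, of the wedge
  products of the dual vectors of \<open>pos i\<close> and \<open>neg j\<close>. Each is a cocycle:
  it ignores the \<open>BX 0\<close> component of a bracket, and its weight
  \<open>\<mu> i - \<mu> j\<close> is zero on \<open>pairs\<close>.\<close>

lemma coord_surj: "\<exists>f\<in>cocycles L 2. \<forall>p\<in>pairs. coord f p = c p"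
proof -
  let ?e = basis_vec
  define \<phi> where "\<phi> x y = (\<Sum>p\<in>pairs. c p *
      (x (pos (fst p)) * y (neg (snd p)) - x (neg (snd p)) * y (pos (fst p))))"
    for x y :: diamond_vec
  let ?f = "\<lambda>zs. if length zs = 2 \<and> set zs \<subseteq> carrier L then \<phi> (zs ! 0) (zs ! 1) else 0"
  have fc: "?f \<in> cochains L 2"
    by (rule cochain_pairI[OF _ _ _ diamond_vectorspace])
       (simp_all add: \<phi>_def algebra_simps sum.distrib sum_subtractf sum_distrib_left)
  have "\<phi> (lbracket L x y) z + \<phi> (lbracket L y z) x + \<phi> (lbracket L z x) y = 0" for x y z
    unfolding \<phi>_def sum.distrib[symmetric]
  proof (rule sum.neutral, rule ballI)
    fix p assume "p \<in> pairs"
    then have p: "fst p \<in> {1..n}" "snd p \<in> {1..n}" "\<mu> (snd p) = \<mu> (fst p)"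
      by (auto simp: pairs_def)
    show "c p * (lbracket L x y (pos (fst p)) * z (neg (snd p)) - lbracket L x y (neg (snd p)) * z (pos (fst p))) +
        c p * (lbracket L y z (pos (fst p)) * x (neg (snd p)) - lbracket L y z (neg (snd p)) * x (pos (fst p))) +
        c p * (lbracket L z x (pos (fst p)) * y (neg (snd p)) - lbracket L z x (neg (snd p)) * y (pos (fst p))) = 0"
      unfolding bracket_coord(1)[OF p(1)] bracket_coord(2)[OF p(2)] p(3) by (simp add: algebra_simps)
  qed
  then have "?f \<in> cocycles L 2"
    unfolding cocycle_iff using fc by (simp add: bracket_closed)
  moreover have val: "?f [?e (pos i), ?e (neg j)] = (if (i, j) \<in> pairs then c (i, j) else 0)"
    if "i \<in> {1..n}" "j \<in> {1..n}" for i j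
  proof -
    have "\<phi> (?e (pos i)) (?e (neg j)) = (\<Sum>p\<in>pairs. if p = (i, j) then c p else 0)"
      unfolding \<phi>_def by (intro sum.cong) (auto simp: basis_vec_def)
    then show ?thesis using that finite_pairs by simp
  qed
  have "coord ?f p = c p" if "p \<in> pairs" for p
  proof -
    obtain i j where ij: "p = (i, j)" "i \<in> {1..n}" "j \<in> {1..n}"
      using \<open>p \<in> pairs\<close> by (auto simp: pairs_def)
    \<comment> \<open>Hence the witness is 0 on (\<open>pos 1\<close>, \<open>neg 1\<close>), and
      \<open>coord\<close> has nothing to subtract.\<close>
    have "(1, 1) \<notin> pairs" by (simp add: pairs_def)
    then show ?thesis
      using that unfolding coord_def ij(1) prod.case val[OF ij(2,3)] val[OF one_mem one_mem] by simp
  qed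
  ultimately show ?thesis by blast
qed

theorem betti_2: "int (betti L 2) = int (card {(i, j) \<in> {1..n} \<times> {1..n}. \<mu> i = \<mu> j}) - 1"
proof -
  let ?P = "{(i, j) \<in> {1..n} \<times> {1..n}. \<mu> i = \<mu> j}"
  have Z: "carrier (cocycle_space L 2) = cocycles L 2"
    "f \<oplus>\<^bsub>cocycle_space L 2\<^esub> g = (\<lambda>zs. f zs + g zs)"
    "r \<odot>\<^bsub>cocycle_space L 2\<^esub> f = (\<lambda>zs. r * f zs)" for f g r
    by (simp_all add: cocycle_space_def)
  have "vectorspace.dim class_ring
      (quotient_space (cocycle_space L 2) {f \<in> carrier (cocycle_space L 2). \<forall>p\<in>pairs. coord f p = 0}) = card pairs"
    by (rule dim_quotient_space_kernel[OF vectorspace_cocycle_space finite_pairs])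
       (auto simp: Z coord_surj, auto simp: coord_def algebra_simps split: prod.splits)
  then have "betti L 2 = card pairs"
    by (simp add: betti_def ce_cohomology_def coboundaries_eq Z)
  moreover have "finite ?P"
    by (rule finite_subset[of _ "{1..n} \<times> {1..n}"]) auto
  moreover have "(1, 1) \<in> ?P" using one_mem by simp
  ultimately have "card ?P = Suc (card pairs)"
    unfolding pairs_def by (intro card.remove)
  with \<open>betti L 2 = card pairs\<close> show ?thesis by simp
qed

end

section \<open>Counting the pairs of equal weights by classes up to sign\<close>

theorem theorem3p2p1:
  fixes n k :: nat and \<Lambda> a :: "nat \<Rightarrow> complex"
  assumes "n \<ge> 1"
    and "\<And>i. i \<in> {1..n} \<Longrightarrow> \<Lambda> i \<noteq> 0"
    and "inj_on a {1..k}"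
    and "\<And>j. j \<in> {1..k} \<Longrightarrow> a j \<noteq> 0"
    and "\<And>i. i \<in> {1..n} \<Longrightarrow> \<exists>!j. j \<in> {1..k} \<and> (a j = \<Lambda> i \<or> a j = - \<Lambda> i)"
    and "\<And>j. j \<in> {1..k} \<Longrightarrow> \<exists>i\<in>{1..n}. a j = \<Lambda> i \<or> a j = - \<Lambda> i"
  shows "int (betti (diamond n \<Lambda>) 2) =
    (\<Sum>j\<in>{1..k}. (int (card {i \<in> {1..n}. \<Lambda> i = a j} + card {i \<in> {1..n}. \<Lambda> i = - a j}))\<^sup>2) - 1"
proof -
  define cl where "cl i = (THE j. j \<in> {1..k} \<and> (a j = \<Lambda> i \<or> a j = - \<Lambda> i))" for i
  have cl: "cl i \<in> {1..k}" "a (cl i) = \<Lambda> i \<or> a (cl i) = - \<Lambda> i" if "i \<in> {1..n}" for i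
    using theI'[OF assms(5)[OF that]] by (auto simp: cl_def)
  have cl_eq: "cl i = j" if "i \<in> {1..n}" "j \<in> {1..k}" "a j = \<Lambda> i \<or> a j = - \<Lambda> i" for i j
    using assms(5)[OF that(1)] cl[OF that(1)] that by blast
  \<comment> \<open>The representative \<open>a (cl i)\<close> of the class of \<open>i\<close>
    serves as \<open>\<mu> i\<close>.\<close>
  interpret signed_diamond n \<Lambda> "\<lambda>i. a (cl i)"
  proof
    fix i j assume i: "i \<in> {1..n}" and j: "j \<in> {1..n}"
    show "a (cl i) = \<Lambda> i \<or> a (cl i) = - \<Lambda> i" using cl(2)[OF i] .
    show "a (cl i) + a (cl j) \<noteq> 0"
    proof
      assume "a (cl i) + a (cl j) = 0"
      then have m: "a (cl j) = - a (cl i)" by (simp add: add_eq_0_iff)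
      \<comment> \<open>Opposite representatives would both equal \<open>\<Lambda> i\<close> up to
        sign, so by uniqueness they have the same index and equal their own negative, against
        \<open>a\<close> being nonzero.\<close>
      then have "cl i = cl j" using cl[OF i] cl[OF j] by (intro cl_eq[OF i]) auto
      with m have "a (cl i) = 0" by simp
      with assms(4) cl(1)[OF i] show False by blast
    qed
  qed (rule assms(1))
  define S where "S j = {i \<in> {1..n}. cl i = j}" for j
  have card_S: "card (S j) = card {i \<in> {1..n}. \<Lambda> i = a j} + card {i \<in> {1..n}. \<Lambda> i = - a j}"
    if j: "j \<in> {1..k}" for j
  proof -
    have "cl i = j \<longleftrightarrow> \<Lambda> i = a j \<or> \<Lambda> i = - a j" if "i \<in> {1..n}" for i
      using cl(2)[OF that] cl_eq[OF that j] by (auto simp: minus_equation_iff)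
    then have "S j = {i \<in> {1..n}. \<Lambda> i = a j} \<union> {i \<in> {1..n}. \<Lambda> i = - a j}"
      unfolding S_def by blast
    \<comment> \<open>This keeps the two sign cases disjoint, so their cardinalities add up.\<close>
    moreover have "a j \<noteq> - a j" using assms(4)[OF j] by simp
    then have "{i \<in> {1..n}. \<Lambda> i = a j} \<inter> {i \<in> {1..n}. \<Lambda> i = - a j} = {}" by auto
    ultimately show ?thesis by (simp add: card_Un_disjoint)
  qed
  \<comment> \<open>Injectivity of \<open>a\<close> makes equality of weights the same as lying in
    one class \<open>S j\<close>; the disjoint squares of the classes then give the sum of
    squares.\<close>
  have "{(i, j) \<in> {1..n} \<times> {1..n}. a (cl i) = a (cl j)} = (\<Union>j\<in>{1..k}. S j \<times> S j)"
  proof (intro equalityI subsetI)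
    fix p assume "p \<in> {(i, j) \<in> {1..n} \<times> {1..n}. a (cl i) = a (cl j)}"
    then obtain i j where ij: "p = (i, j)" "i \<in> {1..n}" "j \<in> {1..n}" "a (cl i) = a (cl j)" by auto
    then have "cl i = cl j" using inj_onD[OF assms(3)] cl(1) by blast
    then show "p \<in> (\<Union>j\<in>{1..k}. S j \<times> S j)" using ij cl(1)[of j] by (auto simp: S_def)
  qed (auto simp: S_def)
  moreover have "card (\<Union>j\<in>{1..k}. S j \<times> S j) = (\<Sum>j\<in>{1..k}. card (S j \<times> S j))"
    by (rule card_UN_disjoint) (auto simp: S_def)
  ultimately have "card {(i, j) \<in> {1..n} \<times> {1..n}. a (cl i) = a (cl j)} = (\<Sum>j\<in>{1..k}. (card (S j))\<^sup>2)"
    by (simp add: card_cartesian_product power2_eq_square)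
  then show ?thesis using card_S by (simp add: betti_2)
qed

end
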